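(* Let $a<0<b$, let $\mathcal F=\mathcal E=L^2([a,b],\mathbb R^4)\times\mathbb R\times\mathbb R^2$ and let $\mathcal B=\mathcal F\times\mathcal E$. The subspace $\mathcal D_{\tilde{\mathcal J}_0}\subset\mathcal B$ consisting of all $$\left(\begin{pmatrix}\tilde f\\ f_I\\ f_\partial\end{pmatrix},\begin{pmatrix}\tilde e\\ e_I\\ e_\partial\end{pmatrix}\right)\in\mathcal F\times\mathcal E,\qquad \tilde f=\begin{bmatrix}f_1\\ f_2\\ f_c\\ f_{\overline c}\end{bmatrix},\quad \tilde e=\begin{bmatrix}e_1\\ e_2\\ e_c\\ e_{\overline c}\end{bmatrix},$$ such that $$\tilde e\in D(\tilde{\mathcal J}_0),\qquad \tilde f=\tilde{\mathcal J}_0\tilde e,\qquad f_I=e_2(0),\qquad e_I=e_1(0^-)-e_1(0^+),\qquad \begin{bmatrix}f_\partial\\ e_\partial\end{bmatrix}=R_{\mathrm{ext}}\begin{bmatrix}e_1(b)\\ e_2(b)\\ e_1(a)\\ e_2(a)\end{bmatrix}$$ is a Dirac structure with respect to the plus pairing $\ll\cdot,\cdot\gg$ on $\mathcal B\times\mathcal B$ induced by the power pairing $$\left\langle \begin{pmatrix}\tilde e\\ e_I\\ e_\partial\end{pmatrix}\Big|\begin{pmatrix}\tilde f\\ f_I\\ f_\partial\end{pmatrix}\right\rangle=\langle\tilde e,\tilde f\rangle_{L^2}+e_If_I-\langle e_\partial,f_\partial\rangle_2 ,$$ i.e. $\mathcal D_{\tilde{\mathcal J}_0}=\mathcal D_{\tilde{\mathcal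 J}_0}^{\perp\!\!\!\perp}$.
   Context: Operators: $c_0=\mathbf 1_{[a,0)}$ and $\overline c_0=\mathbf 1_{(0,b]}$ on $[a,b]$. The operator $\mathbf d_0$ on $L^2([a,b],\mathbb R)$ has domain $D(\mathbf d_0)=H^1([a,b],\mathbb R)$ and $\mathbf d_0x=-\left[\frac{d}{dz}(c_0x)+\frac{d}{dz}(\overline c_0x)\right]$, which is $-\frac{dx}{dz}$ on $(a,0)$ and on $(0,b)$. Its formal adjoint $\mathbf d_0^*$ has domain $D(\mathbf d_0^* )=\{y\in L^2([a,b],\mathbb R): y|_{(a,0)}\in H^1((a,0),\mathbb R),\ y|_{(0,b)}\in H^1((0,b),\mathbb R)\}$ and $\mathbf d_0^*y=\left[\frac{d}{dz}(c_0y)+\frac{d}{dz}(\overline c_0y)\right]-\left[\frac{d}{dz}c_0+\frac{d}{dz}\overline c_0\right]y$, which is the element of $L^2([a,b],\mathbb R)$ equal to the weak derivative $\frac{dy}{dz}$ on $(a,0)$ and on $(0,b)$ (no Dirac mass at $0$). The operator $\tilde{\mathcal J}_0$ on $L^2([a,b],\mathbb R^4)$ has domain $D(\tilde{\mathcal J}_0)=D(\mathbf d_0^* )\times D(\mathbf d_0)\times L^2([a,b],\mathbb R^2)$ and $\tilde{\mathcal J}_0(e_1,e_2,e_c,e_{\overline c})=(\mathbf d_0e_2,\,-\mathbf d_0^*e_1,\,0,\,0)$. $R_{\mathrm{ext}}=\frac1{\sqrt2}\begin{bmatrix}P_1&-P_1\\ I&I\end{bmatrix}\in\mathbb R^{4\times4}$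 with $P_1=\begin{bmatrix}0&-1\\-1&0\end{bmatrix}$ and $I$ the $2\times2$ identity. $e(0^\pm)$ denote one-sided limits at $0$; $\langle\cdot,\cdot\rangle_2$ is the Euclidean inner product; $\langle\cdot,\cdot\rangle_{L^2}$ is the standard inner product of $L^2([a,b],\mathbb R^4)$. Dirac structure: given a power pairing $\langle\cdot|\cdot\rangle:\mathcal E\times\mathcal F\to\mathbb R$, the plus pairing on $\mathcal B=\mathcal F\times\mathcal E$ is $\ll(F^1,E^1),(F^2,E^2)\gg=\langle E^1|F^2\rangle+\langle E^2|F^1\rangle$. For a linear subspace $\mathcal D\subset\mathcal B$, $\mathcal D^{\perp\!\!\!\perp}=\{w\in\mathcal B:\ \ll v,w\gg=0\ \text{for all }v\in\mathcal D\}$. $\mathcal D$ is called a Dirac structure if $\mathcal D=\mathcal D^{\perp\!\!\!\perp}$. *)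

theory Defs
  imports "HOL-Analysis.Analysis" "HOL-Library.Function_Algebras"
begin

text \<open>Pointwise scalar multiplication, so that \<^const>\<open>subspace\<close> applies to sets of tuples of functions.\<close>

instantiation "fun" :: (type, real_vector) real_vector
begin

definition scaleR_fun :: "real \<Rightarrow> ('a \<Rightarrow> 'b) \<Rightarrow> 'a \<Rightarrow> 'b" where
  "scaleR_fun c f = (\<lambda>x. c *\<^sub>R f x)"

instance
  by standard (simp_all add: scaleR_fun_def fun_eq_iff algebra_simps)

end


text \<open>
  An element of $L^2(S)$ is given by any of its representatives: nothing identifies functions that
  agree almost everywhere. In exchange, equality of two $L^2$ elements is always written as equality
  almost everywhere on \<open>S\<close>, and point values of Sobolev functions refer to the continuous
  representative. All sets of functions below are therefore closed under modification on null sets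
  (and under arbitrary modification outside \<open>S\<close>), so an equality of two such sets is the same as
  the equality of the corresponding sets of equivalence classes.
\<close>

definition L2 :: "real set \<Rightarrow> (real \<Rightarrow> 'b::euclidean_space) set" where
  "L2 S = {f \<in> borel_measurable (lebesgue_on S). integrable (lebesgue_on S) (\<lambda>z. (norm (f z))\<^sup>2)}"

definition test_functions :: "real set \<Rightarrow> (real \<Rightarrow> real) set" where
  "test_functions S = {\<phi>. (\<forall>n z. (deriv ^^ n) \<phi> differentiable (at z)) \<and>
                          (\<exists>K. compact K \<and> K \<subseteq> S \<and> (\<forall>z. z \<notin> K \<longrightarrow> \<phi> z = 0))}"

text \<open>The distributional derivative of \<open>u\<close> on the open set \<open>S\<close>, as a functional on test functions.\<close>

definition dist_deriv :: "real set \<Rightarrow> (real \<Rightarrow> real) \<Rightarrow> (real \<Rightarrow> real) \<Rightarrow> real" where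
  "dist_deriv S u \<phi> = - (LINT z|lebesgue_on S. u z * deriv \<phi> z)"

definition is_weak_deriv :: "real set \<Rightarrow> (real \<Rightarrow> real) \<Rightarrow> (real \<Rightarrow> real) \<Rightarrow> bool" where
  "is_weak_deriv S u g \<longleftrightarrow>
     (\<forall>\<phi>\<in>test_functions S. (LINT z|lebesgue_on S. g z * \<phi> z) = dist_deriv S u \<phi>)"

definition H1 :: "real set \<Rightarrow> (real \<Rightarrow> real) set" where
  "H1 S = {u \<in> L2 S. \<exists>g \<in> L2 S. is_weak_deriv S u g}"


definition c0 :: "real \<Rightarrow> real \<Rightarrow> real" where
  "c0 a = indicator {a..<0}"

definition c0bar :: "real \<Rightarrow> real \<Rightarrow> real" where
  "c0bar b = indicator {0<..b}"

definition dom_d0 :: "real \<Rightarrow> real \<Rightarrow> (real \<Rightarrow> real) set" where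
  "dom_d0 a b = {x \<in> L2 {a..b}. x \<in> H1 {a<..<b}}"

text \<open>
  The derivatives of \<open>c0 a \<cdot> x\<close> and \<open>c0bar b \<cdot> x\<close> are distributions on the open interval; for \<open>x\<close> in
  the domain their Dirac masses at \<open>0\<close> cancel and the sum is an $L^2$ function, unique almost
  everywhere.
\<close>

definition d0 :: "real \<Rightarrow> real \<Rightarrow> (real \<Rightarrow> real) \<Rightarrow> real \<Rightarrow> real" where
  "d0 a b x = (SOME f. f \<in> L2 {a..b} \<and>
     (\<forall>\<phi>\<in>test_functions {a<..<b}.
        (LINT z|lebesgue_on {a<..<b}. f z * \<phi> z) =
          - (dist_deriv {a<..<b} (\<lambda>z. c0 a z * x z) \<phi> +
             dist_deriv {a<..<b} (\<lambda>z. c0bar b z * x z) \<phi>)))"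

definition dom_d0_adj :: "real \<Rightarrow> real \<Rightarrow> (real \<Rightarrow> real) set" where
  "dom_d0_adj a b = {y \<in> L2 {a..b}. y \<in> H1 {a<..<0} \<and> y \<in> H1 {0<..<b}}"

text \<open>
  The subtracted term $[\frac{d}{dz} c_0 + \frac{d}{dz} \overline c_0]\, y$ is a Dirac mass times a
  function that may jump at \<open>0\<close>, and it stands for the removal of the Dirac mass from the first
  bracket. What remains is the piecewise weak derivative.
\<close>

definition d0_adj :: "real \<Rightarrow> real \<Rightarrow> (real \<Rightarrow> real) \<Rightarrow> real \<Rightarrow> real" where
  "d0_adj a b y = (SOME g. g \<in> L2 {a..b} \<and> is_weak_deriv {a<..<0} y g \<and> is_weak_deriv {0<..<b} y g)"


definition coord :: "4 \<Rightarrow> (real \<Rightarrow> real^4) \<Rightarrow> real \<Rightarrow> real" where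
  "coord i e = (\<lambda>z. e z $ i)"

definition dom_J0 :: "real \<Rightarrow> real \<Rightarrow> (real \<Rightarrow> real^4) set" where
  "dom_J0 a b = {e. coord 1 e \<in> dom_d0_adj a b \<and> coord 2 e \<in> dom_d0 a b \<and>
                    coord 3 e \<in> L2 {a..b} \<and> coord 4 e \<in> L2 {a..b}}"

definition J0 :: "real \<Rightarrow> real \<Rightarrow> (real \<Rightarrow> real^4) \<Rightarrow> real \<Rightarrow> real^4" where
  "J0 a b e = (\<lambda>z. vector [d0 a b (coord 2 e) z, - d0_adj a b (coord 1 e) z, 0, 0])"


text \<open>On an open interval the continuous representative is unique, and for \<open>u \<in> H1 S\<close> it exists.\<close>

definition cont_rep :: "real set \<Rightarrow> (real \<Rightarrow> real) \<Rightarrow> real \<Rightarrow> real" where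
  "cont_rep S u = (SOME v. continuous_on S v \<and> (AE z in lebesgue_on S. v z = u z))"

definition trace_left :: "real set \<Rightarrow> (real \<Rightarrow> real) \<Rightarrow> real \<Rightarrow> real" where
  "trace_left S u p = Lim (at_left p) (cont_rep S u)"

definition trace_right :: "real set \<Rightarrow> (real \<Rightarrow> real) \<Rightarrow> real \<Rightarrow> real" where
  "trace_right S u p = Lim (at_right p) (cont_rep S u)"


definition stack :: "'a^'n \<Rightarrow> 'a^'m \<Rightarrow> 'a^('n + 'm)" where
  "stack x y = (\<chi> i. case i of Inl j \<Rightarrow> x $ j | Inr k \<Rightarrow> y $ k)"

definition block_matrix ::
  "'a^'n^'k \<Rightarrow> 'a^'m^'k \<Rightarrow> 'a^'n^'l \<Rightarrow> 'a^'m^'l \<Rightarrow> 'a^('n + 'm)^('k + 'l)" where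
  "block_matrix A B C D =
     (\<chi> i. case i of Inl j \<Rightarrow> stack (A $ j) (B $ j) | Inr k \<Rightarrow> stack (C $ k) (D $ k))"

definition P1 :: "real^2^2" where
  "P1 = vector [vector [0, -1], vector [-1, 0]]"

definition R_ext :: "real^(2 + 2)^(2 + 2)" where
  "R_ext = (1 / sqrt 2) *\<^sub>R block_matrix P1 (- P1) (mat 1) (mat 1)"


type_synonym port = "(real \<Rightarrow> real^4) \<times> real \<times> (real^2)"

definition port_space :: "real \<Rightarrow> real \<Rightarrow> port set" where
  "port_space a b = L2 {a..b} \<times> UNIV \<times> UNIV"

definition bond_space :: "real \<Rightarrow> real \<Rightarrow> (port \<times> port) set" where
  "bond_space a b = port_space a b \<times> port_space a b"

text \<open>The effort is the first argument; elements of the bond space are pairs (flow, effort).\<close>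

definition power_pairing :: "real \<Rightarrow> real \<Rightarrow> port \<Rightarrow> port \<Rightarrow> real" where
  "power_pairing a b = (\<lambda>(e, eI, ed) (f, fI, fd).
     (LINT z|lebesgue_on {a..b}. e z \<bullet> f z) + eI * fI - ed \<bullet> fd)"

definition plus_pairing :: "('e \<Rightarrow> 'f \<Rightarrow> real) \<Rightarrow> 'f \<times> 'e \<Rightarrow> 'f \<times> 'e \<Rightarrow> real" where
  "plus_pairing pw = (\<lambda>(F1, E1) (F2, E2). pw E1 F2 + pw E2 F1)"

definition orth_companion ::
  "('f \<times> 'e) set \<Rightarrow> ('e \<Rightarrow> 'f \<Rightarrow> real) \<Rightarrow> ('f \<times> 'e) set \<Rightarrow> ('f \<times> 'e) set" where
  "orth_companion B pw D = {w \<in> B. \<forall>v\<in>D. plus_pairing pw v w = 0}"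

definition dirac_structure ::
  "('f::real_vector \<times> 'e::real_vector) set \<Rightarrow> ('e \<Rightarrow> 'f \<Rightarrow> real) \<Rightarrow> ('f \<times> 'e) set \<Rightarrow> bool" where
  "dirac_structure B pw D \<longleftrightarrow> subspace D \<and> D \<subseteq> B \<and> D = orth_companion B pw D"

text \<open>
  The first component \<open>coord 1 e\<close> is continuous only on either side of \<open>0\<close>, so its value at each point
  is taken from the subinterval adjacent to that point; \<open>coord 2 e\<close> is continuous across \<open>0\<close>.
\<close>

definition D_J0 :: "real \<Rightarrow> real \<Rightarrow> (port \<times> port) set" where
  "D_J0 a b = {((f, fI, fd), (e, eI, ed)).
     ((f, fI, fd), (e, eI, ed)) \<in> bond_space a b \<and>
     e \<in> dom_J0 a b \<and>
     (AE z in lebesgue_on {a..b}. f z = J0 a b e z) \<and>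
     fI = cont_rep {a<..<b} (coord 2 e) 0 \<and>
     eI = trace_left {a<..<0} (coord 1 e) 0 - trace_right {0<..<b} (coord 1 e) 0 \<and>
     stack fd ed = R_ext *v
       stack (vector [trace_left {0<..<b} (coord 1 e) b, trace_left {a<..<b} (coord 2 e) b])
             (vector [trace_right {a<..<0} (coord 1 e) a, trace_right {a<..<b} (coord 2 e) a])}"

end

theory Submission
  imports Defs
begin

text \<open>
  The domain conditions say that $e_2$ agrees almost everywhere with an absolutely continuous
  function on $[a,b]$, and $e_1$ with one on each of $[a,0]$ and $[0,b]$, with derivatives $-f_1$ and
  $-f_2$. Integration by parts on the two subintervals leaves boundary terms at $a$, $0$ (from both sides) and $b$,
  and the port variables are chosen so that these cancel against the finite-dimensional part of the
  pairing; this gives that every two elements of the structure are orthogonal.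

  Conversely, let $w$ be orthogonal to the structure. Pairing $w$ with elements whose effort is a test
  function on $(a,b)$, $(a,0)$ or $(0,b)$ in one coordinate shows that the efforts of $w$ have the
  required weak derivatives. Pairing it with polynomial efforts then isolates each of the boundary
  values one at a time.
\<close>

subsection \<open>Square-integrable functions\<close>

text \<open>\<open>d0\<close>, \<open>d0_adj\<close> and \<open>cont_rep\<close> are choices by
  \<open>SOME\<close>, so not even linearity of the structure is visible from \<open>D_J0\<close>.
  Everything is therefore moved to \<open>port_rep\<close>: explicit absolutely continuous functions
  \<open>vl\<close>, \<open>vr\<close>, \<open>v2\<close> for the efforts, whose derivatives are
  read off the flows and whose values at \<open>a\<close>, \<open>0\<close>, \<open>b\<close> give
  the port variables. The equivalence \<open>D_J0_iff\<close> rests on regularity theory: a weak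
  derivative in L2 forces an absolutely continuous representative (du Bois-Reymond), which needs a
  supply of test functions, and integration by parts must hold for functions with a merely
  integrable derivative, which is obtained from Fubini. The two efforts behave differently because
  of the pairing. A test effort in the first coordinate may be nonzero at \<open>0\<close> as long
  as it does not jump, so the second effort is tested across \<open>0\<close>. A test effort in the
  second coordinate meets the unknown \<open>eI\<close> unless it vanishes at \<open>0\<close>, so
  the first effort is tested on either side only and may jump. The last two flows vanish because the
  efforts there are unrestricted.\<close>

lemma integrable_lebesgue_on_subset:
  fixes f :: "real \<Rightarrow> 'b::euclidean_space"
  assumes "integrable (lebesgue_on S) f" "T \<subseteq> S" "S \<in> sets lebesgue" "T \<in> sets lebesgue"
  shows "integrable (lebesgue_on T) f"
proof -
  have "set_integrable lebesgue S f"
    using assms(1,3) by (simp add: set_integrable_def integrable_restrict_space)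
  then have "set_integrable lebesgue T f"
    using assms(2,4) set_integrable_subset by blast
  then show ?thesis
    using assms(4) by (simp add: set_integrable_def integrable_restrict_space)
qed

lemma measurable_lebesgue_on_subset:
  assumes "f \<in> borel_measurable (lebesgue_on S)" "T \<subseteq> S"
  shows "f \<in> borel_measurable (lebesgue_on T)"
  using assms by (rule measurable_restrict_mono)

lemma measurable_lebesgue_on_cong_AE:
  fixes f g :: "real \<Rightarrow> 'b::euclidean_space"
  assumes "f \<in> borel_measurable (lebesgue_on S)" "AE z in lebesgue_on S. f z = g z" "S \<in> sets lebesgue"
  shows "g \<in> borel_measurable (lebesgue_on S)"
proof -
  have "AE x in lebesgue. indicator S x *\<^sub>R f x = indicator S x *\<^sub>R g x"
    using assms(2,3) by (auto simp: AE_restrict_space_iff indicator_def elim: eventually_mono)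
  then have "(\<lambda>x. indicator S x *\<^sub>R g x) \<in> borel_measurable lebesgue"
    using assms(1,3) by (auto simp: borel_measurable_restrict_space_iff intro: borel_measurable_AE)
  then show ?thesis using assms(3) by (simp add: borel_measurable_restrict_space_iff)
qed

lemma L2_D:
  assumes "f \<in> L2 S"
  shows "f \<in> borel_measurable (lebesgue_on S)" "integrable (lebesgue_on S) (\<lambda>z. (norm (f z))\<^sup>2)"
  using assms by (auto simp: L2_def)

lemma L2_bound:
  assumes "f \<in> borel_measurable (lebesgue_on S)"
    and "integrable (lebesgue_on S) h" and "\<And>z. z \<in> S \<Longrightarrow> (norm (f z))\<^sup>2 \<le> h z"
  shows "f \<in> L2 S"
proof -
  have "integrable (lebesgue_on S) (\<lambda>z. (norm (f z))\<^sup>2)"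
  proof (rule Bochner_Integration.integrable_bound[OF assms(2)])
    show "(\<lambda>z. (norm (f z))\<^sup>2) \<in> borel_measurable (lebesgue_on S)"
      using assms(1) by measurable
    show "AE z in lebesgue_on S. norm ((norm (f z))\<^sup>2) \<le> norm (h z)"
      using assms(3) by (auto intro!: AE_I2 order_trans[OF _ abs_ge_self])
  qed
  then show ?thesis using assms(1) by (simp add: L2_def)
qed

lemma integrable_L2_inner:
  assumes "f \<in> L2 S" "g \<in> L2 S"
  shows "integrable (lebesgue_on S) (\<lambda>z. f z \<bullet> g z)"
proof (rule Bochner_Integration.integrable_bound)
  show "integrable (lebesgue_on S) (\<lambda>z. (norm (f z))\<^sup>2 + (norm (g z))\<^sup>2)"
    using assms by (auto dest: L2_D)
  show "(\<lambda>z. f z \<bullet> g z) \<in> borel_measurable (lebesgue_on S)"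
    using assms by (auto dest!: L2_D(1))
  have "\<bar>x \<bullet> y\<bar> \<le> (norm x)\<^sup>2 + (norm y)\<^sup>2" for x y :: 'a
  proof -
    have "\<bar>x \<bullet> y\<bar> \<le> norm x * norm y" by (rule Cauchy_Schwarz_ineq2)
    also have "\<dots> \<le> (norm x)\<^sup>2 + (norm y)\<^sup>2"
      using sum_squares_bound[of "norm x" "norm y"]
        mult_nonneg_nonneg[OF norm_ge_zero[of x] norm_ge_zero[of y]] by linarith
    finally show ?thesis .
  qed
  then show "AE z in lebesgue_on S. norm (f z \<bullet> g z) \<le> norm ((norm (f z))\<^sup>2 + (norm (g z))\<^sup>2)"
    by simp
qed

lemma integrable_L2_mult:
  fixes f g :: "real \<Rightarrow> real"
  assumes "f \<in> L2 S" "g \<in> L2 S"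
  shows "integrable (lebesgue_on S) (\<lambda>z. f z * g z)"
  using integrable_L2_inner[OF assms] by simp

lemma L2_add:
  assumes "f \<in> L2 S" "g \<in> L2 S"
  shows "(\<lambda>z. f z + g z) \<in> L2 S"
proof (rule L2_bound)
  show "(\<lambda>z. f z + g z) \<in> borel_measurable (lebesgue_on S)"
    using assms by (auto dest!: L2_D(1))
  show "integrable (lebesgue_on S) (\<lambda>z. 2 * (norm (f z))\<^sup>2 + 2 * (norm (g z))\<^sup>2)"
    by (intro Bochner_Integration.integrable_add integrable_mult_right L2_D(2) assms)
  have "(norm (x + y))\<^sup>2 \<le> 2 * (norm x)\<^sup>2 + 2 * (norm y)\<^sup>2" for x y :: 'a
    using zero_le_power2[of "norm (x - y)"] unfolding power2_norm_eq_inner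
    by (simp add: inner_simps inner_commute)
  then show "(norm (f z + g z))\<^sup>2 \<le> 2 * (norm (f z))\<^sup>2 + 2 * (norm (g z))\<^sup>2" for z .
qed

lemma L2_scaleR:
  assumes "f \<in> L2 S"
  shows "(\<lambda>z. c *\<^sub>R f z) \<in> L2 S"
proof (rule L2_bound)
  show "(\<lambda>z. c *\<^sub>R f z) \<in> borel_measurable (lebesgue_on S)"
    using assms by (auto dest!: L2_D(1))
  show "integrable (lebesgue_on S) (\<lambda>z. c\<^sup>2 * (norm (f z))\<^sup>2)"
    using assms by (auto dest: L2_D)
qed (simp add: power_mult_distrib)

lemma L2_minus:
  assumes "f \<in> L2 S"
  shows "(\<lambda>z. - f z) \<in> L2 S"
  using L2_scaleR[OF assms, of "-1"] by simp

lemma L2_zero: "(\<lambda>z. 0) \<in> L2 S"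
  by (simp add: L2_def)

lemma L2_cong_AE:
  assumes "f \<in> L2 S" "AE z in lebesgue_on S. f z = g z" "S \<in> sets lebesgue"
  shows "g \<in> L2 S"
proof -
  obtain m: "f \<in> borel_measurable (lebesgue_on S)" and i: "integrable (lebesgue_on S) (\<lambda>z. (norm (f z))\<^sup>2)"
    using assms(1) by (auto simp: L2_def)
  have m': "g \<in> borel_measurable (lebesgue_on S)"
    by (rule measurable_lebesgue_on_cong_AE[OF m assms(2,3)])
  have "integrable (lebesgue_on S) (\<lambda>z. (norm (g z))\<^sup>2)"
    by (rule integrable_cong_AE_imp[OF i]) (use m' assms(2) in auto)
  then show ?thesis using m' by (simp add: L2_def)
qed

lemma L2_subset:
  assumes "f \<in> L2 S" "T \<subseteq> S" "S \<in> sets lebesgue" "T \<in> sets lebesgue"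
  shows "f \<in> L2 T"
  unfolding L2_def mem_Collect_eq
  using assms(2,3,4) L2_D[OF assms(1)]
  by (auto intro: measurable_lebesgue_on_subset integrable_lebesgue_on_subset)

lemma L2_continuous:
  fixes f :: "real \<Rightarrow> 'b::euclidean_space"
  assumes "continuous_on {\<alpha>..\<beta>} f"
  shows "f \<in> L2 {\<alpha>..\<beta>}"
  unfolding L2_def mem_Collect_eq
  by (intro conjI continuous_imp_measurable_on_sets_lebesgue continuous_imp_integrable_real
      continuous_intros assms) auto

lemma integrable_L2:
  fixes f :: "real \<Rightarrow> real"
  assumes "f \<in> L2 S" "S \<in> lmeasurable"
  shows "integrable (lebesgue_on S) f"
proof -
  have "(\<lambda>z. 1::real) \<in> L2 S"
    using assms(2) finite_measure_lebesgue_on finite_measure.integrable_const by (auto simp: L2_def)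
  from integrable_L2_mult[OF assms(1) this] show ?thesis by simp
qed

lemma L2_coord: "e \<in> L2 S \<longleftrightarrow> (\<forall>i. coord i e \<in> L2 S)"
proof
  assume e: "e \<in> L2 S"
  show "\<forall>i. coord i e \<in> L2 S"
  proof
    fix i
    show "coord i e \<in> L2 S"
    proof (rule L2_bound)
      show "coord i e \<in> borel_measurable (lebesgue_on S)"
        using L2_D(1)[OF e] unfolding coord_def
        by (simp add: borel_measurable_euclidean_space[of e] Basis_vec_def inner_axis)
      show "integrable (lebesgue_on S) (\<lambda>z. (norm (e z))\<^sup>2)" by (rule L2_D[OF e])
    qed (simp add: coord_def component_le_norm_cart power_mono abs_le_square_iff[symmetric])
  qed
next
  assume *: "\<forall>i. coord i e \<in> L2 S"
  show "e \<in> L2 S"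
  proof (rule L2_bound)
    show "e \<in> borel_measurable (lebesgue_on S)"
      using * L2_D(1)
      by (auto simp: borel_measurable_euclidean_space[of e] Basis_vec_def inner_axis coord_def)
    show "integrable (lebesgue_on S) (\<lambda>z. \<Sum>i\<in>UNIV. (norm (coord i e z))\<^sup>2)"
      using * by (intro Bochner_Integration.integrable_sum L2_D(2)) auto
  qed (simp add: coord_def norm_vec_def L2_set_def sum_nonneg)
qed

text \<open>The bond space lives on closed intervals, weak derivatives on open ones. The endpoints
  are null, so almost-everywhere statements, integrals and square integrability pass between the
  two, here and in the next lemmas.\<close>

lemma AE_lebesgue_on_Icc_iff_Ioo:
  fixes \<alpha> \<beta> :: real
  shows "(AE z in lebesgue_on {\<alpha>..\<beta>}. P z) \<longleftrightarrow> (AE z in lebesgue_on {\<alpha><..<\<beta>}. P z)"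
proof -
  have "AE z in lebesgue. z \<noteq> \<alpha> \<and> z \<noteq> \<beta>"
    by (intro eventually_conj AE_completion AE_lborel_singleton)
  then show ?thesis
    by (auto simp: AE_restrict_space_iff elim!: eventually_elim2)
qed

lemma integrable_Icc_iff_Ioo:
  fixes f :: "real \<Rightarrow> real"
  shows "integrable (lebesgue_on {\<alpha>..\<beta>}) f \<longleftrightarrow> integrable (lebesgue_on {\<alpha><..<\<beta>}) f"
  using absolutely_integrable_on_Icc_iff_Ioo[of \<alpha> \<beta> f]
  by (simp add: set_integrable_def integrable_restrict_space)

lemma LINT_Icc_eq_Ioo:
  fixes f :: "real \<Rightarrow> real"
  shows "(LINT z|lebesgue_on {\<alpha>..\<beta>}. f z) = (LINT z|lebesgue_on {\<alpha><..<\<beta>}. f z)"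
proof (cases "integrable (lebesgue_on {\<alpha>..\<beta>}) f")
  case True
  then have "integrable (lebesgue_on {\<alpha><..<\<beta>}) f" by (simp add: integrable_Icc_iff_Ioo)
  with True show ?thesis
    by (simp add: lebesgue_integral_eq_integral integral_open_interval_real)
next
  case False
  then show ?thesis
    using integrable_Icc_iff_Ioo[of \<alpha> \<beta> f] by (simp add: not_integrable_integral_eq)
qed

lemma L2_Icc_iff_Ioo:
  fixes f :: "real \<Rightarrow> real"
  shows "f \<in> L2 {\<alpha>..\<beta>} \<longleftrightarrow> f \<in> L2 {\<alpha><..<\<beta>}"
proof
  assume f: "f \<in> L2 {\<alpha><..<\<beta>}"
  let ?f = "\<lambda>z. indicator {\<alpha><..<\<beta>} z *\<^sub>R f z"
  have "?f \<in> borel_measurable lebesgue"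
    using L2_D(1)[OF f] by (simp add: borel_measurable_restrict_space_iff)
  moreover have "integrable (lebesgue_on {\<alpha>..\<beta>}) (\<lambda>z. (norm (?f z))\<^sup>2)"
    unfolding integrable_Icc_iff_Ioo using L2_D(2)[OF f]
    by (rule Bochner_Integration.integrable_cong[THEN iffD1, rotated -1]) auto
  ultimately have "?f \<in> L2 {\<alpha>..\<beta>}"
    by (auto simp: L2_def measurable_restrict_space1)
  moreover have "AE z in lebesgue_on {\<alpha>..\<beta>}. ?f z = f z"
    unfolding AE_lebesgue_on_Icc_iff_Ioo by (rule AE_I2) simp
  ultimately show "f \<in> L2 {\<alpha>..\<beta>}"
    by (rule L2_cong_AE) simp
qed (auto intro: L2_subset)

subsection \<open>Absolutely continuous functions\<close>

text \<open>Moves the variable endpoint into the integrand, so that iterated integrals range over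
  one fixed measure space as Fubini requires.\<close>

lemma integral_lebesgue_on_eq:
  fixes f :: "real \<Rightarrow> real"
  assumes "integrable (lebesgue_on {\<alpha>..\<beta>}) f" "x \<in> {\<alpha>..\<beta>}"
  shows "integral {\<alpha>..x} f = (LINT t|lebesgue_on {\<alpha>..\<beta>}. indicator {..x} t * f t)"
proof -
  have "integrable (lebesgue_on {\<alpha>..x}) f"
    by (rule integrable_lebesgue_on_subset[OF assms(1)]) (use assms(2) in auto)
  then have "integral {\<alpha>..x} f = (LINT t|lebesgue_on {\<alpha>..x}. f t)"
    by (simp add: lebesgue_integral_eq_integral)
  also have "\<dots> = (LINT t|lebesgue. indicator {\<alpha>..x} t * f t)"
    by (simp add: integral_restrict_space)
  also have "\<dots> = (LINT t|lebesgue. indicator {\<alpha>..\<beta>} t * (indicator {..x} t * f t))"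
    using assms(2) by (intro Bochner_Integration.integral_cong) (auto simp: indicator_def)
  also have "\<dots> = (LINT t|lebesgue_on {\<alpha>..\<beta>}. indicator {..x} t * f t)"
    by (simp add: integral_restrict_space)
  finally show ?thesis .
qed

text \<open>The two integrals range over the two triangles into which the diagonal cuts the square.\<close>

lemma Fubini_triangles:
  fixes g h :: "real \<Rightarrow> real"
  assumes g: "integrable (lebesgue_on {\<alpha>..\<beta>}) g" and h: "integrable (lebesgue_on {\<alpha>..\<beta>}) h"
  shows "(LINT s|lebesgue_on {\<alpha>..\<beta>}. (LINT t|lebesgue_on {\<alpha>..\<beta>}. indicator {..s} t * g t) * h s) +
         (LINT s|lebesgue_on {\<alpha>..\<beta>}. (LINT t|lebesgue_on {\<alpha>..\<beta>}. indicator {..s} t * h t) * g s) =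
         (LINT s|lebesgue_on {\<alpha>..\<beta>}. g s) * (LINT s|lebesgue_on {\<alpha>..\<beta>}. h s)"
proof -
  let ?M = "lebesgue_on {\<alpha>..\<beta>}"
  interpret finite_measure ?M by (rule finite_measure_lebesgue_on) simp
  interpret pair_sigma_finite ?M ?M ..
  have idm[measurable]: "(\<lambda>x. x) \<in> borel_measurable ?M"
    using id_borel_measurable_lebesgue_on[of "{\<alpha>..\<beta>}"] by (simp add: id_def)
  have [measurable]: "g \<in> borel_measurable ?M" "h \<in> borel_measurable ?M"
    using g h by auto
  have prod: "integrable (?M \<Otimes>\<^sub>M ?M) (\<lambda>(s, t). g t * h s)"
  proof (rule Fubini_integrable)
    show "integrable ?M (\<lambda>x. LINT y|?M. norm (case (x, y) of (s, t) \<Rightarrow> g t * h s))"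
      using g h by (simp add: abs_mult)
    show "AE x in ?M. integrable ?M (\<lambda>y. case (x, y) of (s, t) \<Rightarrow> g t * h s)"
      using g h by simp
  qed measurable
  have low: "integrable (?M \<Otimes>\<^sub>M ?M) (\<lambda>(s, t). of_bool (t \<le> s) * g t * h s)"
  proof (rule Bochner_Integration.integrable_bound[OF prod])
    show "(\<lambda>(s, t). of_bool (t \<le> s) * g t * h s) \<in> borel_measurable (?M \<Otimes>\<^sub>M ?M)"
      by measurable
  qed (auto simp: abs_mult)
  have up: "integrable (?M \<Otimes>\<^sub>M ?M) (\<lambda>(s, t). of_bool (s < t) * g t * h s)"
  proof (rule Bochner_Integration.integrable_bound[OF prod])
    show "(\<lambda>(s, t). of_bool (s < t) * g t * h s) \<in> borel_measurable (?M \<Otimes>\<^sub>M ?M)"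
      by measurable
  qed (auto simp: abs_mult)
  have "(LINT s|?M. (LINT t|?M. indicator {..s} t * g t) * h s) =
        (LINT s|?M. LINT t|?M. of_bool (t \<le> s) * g t * h s)"
    unfolding integral_mult_left_zero[symmetric]
    by (simp only: indicator_def atMost_iff of_bool_def)
  moreover have "(LINT s|?M. (LINT t|?M. indicator {..s} t * h t) * g s) =
        (LINT s|?M. LINT t|?M. of_bool (s < t) * g t * h s)"
  proof -
    \<comment> \<open>For each \<open>s\<close> the diagonal point \<open>t = s\<close> is null;
      dropping it makes the two triangles disjoint, and they then add up to the whole
      square.\<close>
    have "(LINT t|?M. indicator {..s} t * h t) = (LINT t|?M. of_bool (t < s) * h t)" for s
    proof (rule integral_cong_AE)
      have "AE t in lebesgue. t \<noteq> s"
        by (auto intro: AE_completion AE_lborel_singleton)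
      then have "AE t in ?M. t \<noteq> s"
        by (simp add: AE_restrict_space_iff eventually_mono)
      then show "AE t in ?M. indicator {..s} t * h t = of_bool (t < s) * h t"
        by eventually_elim (auto simp: indicator_def)
    qed (auto intro!: borel_measurable_times)
    then have "(LINT s|?M. (LINT t|?M. indicator {..s} t * h t) * g s) =
        (LINT s|?M. (LINT t|?M. of_bool (t < s) * h t) * g s)"
      by (simp only:)
    also have "\<dots> = (LINT s|?M. LINT t|?M. of_bool (t < s) * h t * g s)"
      by (simp only: integral_mult_left_zero)
    \<comment> \<open>The bound variables trade names here; the next step exchanges the order of
      integration.\<close>
    also have "\<dots> = (LINT t|?M. LINT s|?M. of_bool (s < t) * g t * h s)"
      by (simp only: mult.assoc mult.commute[of "h _"])
    also have "\<dots> = (LINT s|?M. LINT t|?M. of_bool (s < t) * g t * h s)"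
      by (rule Fubini_integral[OF up])
    finally show ?thesis .
  qed
  moreover have "(LINT s|?M. LINT t|?M. of_bool (t \<le> s) * g t * h s) +
      (LINT s|?M. LINT t|?M. of_bool (s < t) * g t * h s) = (LINT s|?M. LINT t|?M. g t * h s)"
  proof -
    have "(LINT s|?M. LINT t|?M. of_bool (t \<le> s) * g t * h s) +
        (LINT s|?M. LINT t|?M. of_bool (s < t) * g t * h s) =
       integral\<^sup>L (?M \<Otimes>\<^sub>M ?M) (\<lambda>(s, t). of_bool (t \<le> s) * g t * h s) +
       integral\<^sup>L (?M \<Otimes>\<^sub>M ?M) (\<lambda>(s, t). of_bool (s < t) * g t * h s)"
      by (simp only: integral_fst[OF low] integral_fst[OF up])
    also have "\<dots> = integral\<^sup>L (?M \<Otimes>\<^sub>M ?M) (\<lambda>(s, t). g t * h s)"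
      by (subst Bochner_Integration.integral_add[OF low up, symmetric])
         (auto intro!: Bochner_Integration.integral_cong)
    also have "\<dots> = (LINT s|?M. LINT t|?M. g t * h s)"
      by (rule integral_fst[OF prod, symmetric])
    finally show ?thesis .
  qed
  moreover have "(LINT s|?M. LINT t|?M. g t * h s) = (LINT s|?M. g s) * (LINT s|?M. h s)"
    by simp
  ultimately show ?thesis by argo
qed

text \<open>Absolute continuity in its fundamental-theorem form, with the almost-everywhere
  derivative \<open>g\<close> carried along as data. As \<open>g\<close> is Lebesgue integrable, the
  gauge integral \<open>integral\<close> agrees with the Lebesgue one and results on both
  apply.\<close>

definition ac_on :: "real \<Rightarrow> real \<Rightarrow> (real \<Rightarrow> real) \<Rightarrow> (real \<Rightarrow> real) \<Rightarrow> bool" where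
  "ac_on \<alpha> \<beta> v g \<longleftrightarrow> integrable (lebesgue_on {\<alpha>..\<beta>}) g \<and>
     (\<forall>x\<in>{\<alpha>..\<beta>}. v x = v \<alpha> + integral {\<alpha>..x} g)"

lemma ac_on_integrable: "ac_on \<alpha> \<beta> v g \<Longrightarrow> integrable (lebesgue_on {\<alpha>..\<beta>}) g"
  by (simp add: ac_on_def)

lemma ac_on_eq: "ac_on \<alpha> \<beta> v g \<Longrightarrow> x \<in> {\<alpha>..\<beta>} \<Longrightarrow> integral {\<alpha>..x} g = v x - v \<alpha>"
  unfolding ac_on_def by (metis add_diff_cancel_left')

lemma ac_onI:
  assumes "integrable (lebesgue_on {\<alpha>..\<beta>}) g"
    and "\<And>x. \<alpha> \<le> x \<Longrightarrow> x \<le> \<beta> \<Longrightarrow> integral {\<alpha>..x} g = v x - v \<alpha>"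
  shows "ac_on \<alpha> \<beta> v g"
  using assms by (simp add: ac_on_def)

lemma ac_on_continuous:
  assumes "ac_on \<alpha> \<beta> v g"
  shows "continuous_on {\<alpha>..\<beta>} v"
proof -
  have "g integrable_on {\<alpha>..\<beta>}"
    using ac_on_integrable[OF assms] by (auto intro: integrable_on_lebesgue_on)
  then have "continuous_on {\<alpha>..\<beta>} (\<lambda>x. v \<alpha> + integral {\<alpha>..x} g)"
    by (intro continuous_intros indefinite_integral_continuous_1)
  then show ?thesis
    by (rule continuous_on_eq) (simp add: ac_on_eq[OF assms])
qed

lemma integrable_continuous_mult:
  fixes p q :: "real \<Rightarrow> real"
  assumes p: "continuous_on {\<alpha>..\<beta>} p" and q: "integrable (lebesgue_on {\<alpha>..\<beta>}) q"
  shows "integrable (lebesgue_on {\<alpha>..\<beta>}) (\<lambda>z. p z * q z)"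
proof -
  have "bounded (p ` {\<alpha>..\<beta>})"
    by (intro compact_imp_bounded compact_continuous_image p) simp
  then obtain B where "\<forall>y\<in>p ` {\<alpha>..\<beta>}. norm y \<le> B"
    unfolding bounded_iff by blast
  then have B: "\<bar>p z\<bar> \<le> B" if "z \<in> {\<alpha>..\<beta>}" for z
    using that by simp
  have "integrable (lebesgue_on {\<alpha>..\<beta>}) (\<lambda>z. B * q z)" using q by simp
  then show ?thesis
  proof (rule Bochner_Integration.integrable_bound)
    show "(\<lambda>z. p z * q z) \<in> borel_measurable (lebesgue_on {\<alpha>..\<beta>})"
      using continuous_imp_measurable_on_sets_lebesgue[OF p] q by auto
    show "AE z in (lebesgue_on {\<alpha>..\<beta>}). norm (p z * q z) \<le> norm (B * q z)"
      using B by (intro AE_I2) (fastforce simp: abs_mult intro: mult_right_mono order_trans[OF _ abs_ge_self])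
  qed
qed

text \<open>With \<open>v\<close> and \<open>w\<close> written as initial value plus indefinite
  integral, the constants contribute multiples of the integrals of \<open>h\<close> and
  \<open>g\<close>, and what is left is the identity of the two triangles. A product rule would ask
  for derivatives at every point.\<close>

lemma ac_on_integration_by_parts:
  assumes v: "ac_on \<alpha> \<beta> v g" and w: "ac_on \<alpha> \<beta> w h" and "\<alpha> \<le> \<beta>"
  shows "integrable (lebesgue_on {\<alpha>..\<beta>}) (\<lambda>z. v z * h z)"
    and "integrable (lebesgue_on {\<alpha>..\<beta>}) (\<lambda>z. w z * g z)"
    and "(LINT z|lebesgue_on {\<alpha>..\<beta>}. v z * h z) + (LINT z|lebesgue_on {\<alpha>..\<beta>}. w z * g z) =
      v \<beta> * w \<beta> - v \<alpha> * w \<alpha>"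
proof -
  let ?M = "lebesgue_on {\<alpha>..\<beta>}"
  define V where "V = (\<lambda>s. LINT t|?M. indicator {..s} t * g t)"
  define W where "W = (\<lambda>s. LINT t|?M. indicator {..s} t * h t)"
  have g: "integrable ?M g" and h: "integrable ?M h" using v w by (auto dest: ac_on_integrable)
  have veq: "v s = v \<alpha> + V s" and weq: "w s = w \<alpha> + W s" if "s \<in> {\<alpha>..\<beta>}" for s
    using ac_on_eq[OF v that] ac_on_eq[OF w that]
      integral_lebesgue_on_eq[OF g that] integral_lebesgue_on_eq[OF h that]
    unfolding V_def W_def by linarith+
  have veq': "V s = v s - v \<alpha>" and weq': "W s = w s - w \<alpha>" if "s \<in> {\<alpha>..\<beta>}" for s
    using veq[OF that] weq[OF that] by simp_all
  show vh: "integrable ?M (\<lambda>z. v z * h z)" and wg: "integrable ?M (\<lambda>z. w z * g z)"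
    using integrable_continuous_mult ac_on_continuous v w g h by auto
  have Vh: "integrable ?M (\<lambda>z. V z * h z)"
  proof -
    have "integrable ?M (\<lambda>z. v z * h z - v \<alpha> * h z)" using vh h by simp
    then show ?thesis
      by (rule Bochner_Integration.integrable_cong[THEN iffD1, rotated -1])
         (simp_all add: veq' algebra_simps)
  qed
  have Wg: "integrable ?M (\<lambda>z. W z * g z)"
  proof -
    have "integrable ?M (\<lambda>z. w z * g z - w \<alpha> * g z)" using wg g by simp
    then show ?thesis
      by (rule Bochner_Integration.integrable_cong[THEN iffD1, rotated -1])
         (simp_all add: weq' algebra_simps)
  qed
  have "(LINT z|?M. v z * h z) = (LINT z|?M. v \<alpha> * h z + V z * h z)"
    by (rule Bochner_Integration.integral_cong) (simp_all add: veq' algebra_simps)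
  also have "\<dots> = v \<alpha> * (LINT z|?M. h z) + (LINT z|?M. V z * h z)"
    using h Vh by simp
  finally have 1: "(LINT z|?M. v z * h z) = \<dots>" .
  have "(LINT z|?M. w z * g z) = (LINT z|?M. w \<alpha> * g z + W z * g z)"
    by (rule Bochner_Integration.integral_cong) (simp_all add: weq' algebra_simps)
  also have "\<dots> = w \<alpha> * (LINT z|?M. g z) + (LINT z|?M. W z * g z)"
    using g Wg by simp
  finally have 2: "(LINT z|?M. w z * g z) = \<dots>" .
  have 3: "(LINT z|?M. V z * h z) + (LINT z|?M. W z * g z) = (LINT z|?M. g z) * (LINT z|?M. h z)"
    unfolding V_def W_def by (rule Fubini_triangles[OF g h])
  have "(LINT z|?M. g z) = V \<beta>" "(LINT z|?M. h z) = W \<beta>"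
    unfolding V_def W_def by (auto intro!: Bochner_Integration.integral_cong)
  then have "(LINT z|?M. g z) = v \<beta> - v \<alpha>" "(LINT z|?M. h z) = w \<beta> - w \<alpha>"
    using veq'[of \<beta>] weq'[of \<beta>] \<open>\<alpha> \<le> \<beta>\<close> by simp_all
  with 1 2 3 show "(LINT z|?M. v z * h z) + (LINT z|?M. w z * g z) = v \<beta> * w \<beta> - v \<alpha> * w \<alpha>"
    by (simp add: algebra_simps)
qed

lemma ac_on_mult_left:
  assumes "ac_on \<alpha> \<beta> v g"
  shows "ac_on \<alpha> \<beta> (\<lambda>z. c * v z) (\<lambda>z. c * g z)"
proof (rule ac_onI)
  show "integrable (lebesgue_on {\<alpha>..\<beta>}) (\<lambda>z. c * g z)"
    using ac_on_integrable[OF assms] by simp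
qed (simp add: ac_on_eq[OF assms] right_diff_distrib)

lemma ac_on_integrable_on:
  assumes "ac_on \<alpha> \<beta> v g" "\<alpha> \<le> \<gamma>" "\<delta> \<le> \<beta>"
  shows "g integrable_on {\<gamma>..\<delta>}" "integrable (lebesgue_on {\<gamma>..\<delta>}) g"
proof -
  show "integrable (lebesgue_on {\<gamma>..\<delta>}) g"
    by (rule integrable_lebesgue_on_subset[OF ac_on_integrable[OF assms(1)]]) (use assms in auto)
  then show "g integrable_on {\<gamma>..\<delta>}"
    by (rule integrable_on_lebesgue_on) simp
qed

lemma ac_on_add:
  assumes "ac_on \<alpha> \<beta> v g" "ac_on \<alpha> \<beta> w h"
  shows "ac_on \<alpha> \<beta> (\<lambda>z. v z + w z) (\<lambda>z. g z + h z)"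
proof (rule ac_onI)
  show "integrable (lebesgue_on {\<alpha>..\<beta>}) (\<lambda>z. g z + h z)"
    using assms[THEN ac_on_integrable] by simp
  fix x assume "\<alpha> \<le> x" "x \<le> \<beta>"
  then have "integral {\<alpha>..x} (\<lambda>z. g z + h z) = integral {\<alpha>..x} g + integral {\<alpha>..x} h"
    using assms by (intro Henstock_Kurzweil_Integration.integral_add ac_on_integrable_on(1)) auto
  then show "integral {\<alpha>..x} (\<lambda>z. g z + h z) = v x + w x - (v \<alpha> + w \<alpha>)"
    using \<open>\<alpha> \<le> x\<close> \<open>x \<le> \<beta>\<close> by (simp add: ac_on_eq[OF assms(1)] ac_on_eq[OF assms(2)])
qed

lemma ac_on_cong_AE:
  assumes "ac_on \<alpha> \<beta> v g" "AE z in lebesgue_on {\<alpha>..\<beta>}. g z = h z"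
  shows "ac_on \<alpha> \<beta> v h"
proof (rule ac_onI)
  have neg: "negligible {z. \<not> (z \<in> {\<alpha>..\<beta>} \<longrightarrow> g z = h z)}"
    using assms(2) by (auto simp: AE_restrict_space_iff negligible_iff_null_sets completion.null_sets_iff_AE
        elim: eventually_mono)
  have "h \<in> borel_measurable (lebesgue_on {\<alpha>..\<beta>})"
    by (rule measurable_lebesgue_on_cong_AE[OF borel_measurable_integrable assms(2)])
       (simp_all add: ac_on_integrable[OF assms(1)])
  then show "integrable (lebesgue_on {\<alpha>..\<beta>}) h"
    by (rule integrable_cong_AE_imp[OF ac_on_integrable[OF assms(1)]])
       (use assms(2) in \<open>simp add: eq_commute\<close>)
  fix x assume x: "\<alpha> \<le> x" "x \<le> \<beta>"
  have "integral {\<alpha>..x} h = integral {\<alpha>..x} g"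
    by (rule integral_spike[OF neg]) (use x in auto)
  then show "integral {\<alpha>..x} h = v x - v \<alpha>"
    using ac_on_eq[OF assms(1)] x by simp
qed

lemma ac_on_zero: "ac_on \<alpha> \<beta> (\<lambda>z. 0) (\<lambda>z. 0)"
  by (simp add: ac_on_def)

lemma ac_on_subinterval:
  assumes "ac_on \<alpha> \<beta> v g" "\<alpha> \<le> \<gamma>" "\<delta> \<le> \<beta>"
  shows "ac_on \<gamma> \<delta> v g"
proof (rule ac_onI)
  show "integrable (lebesgue_on {\<gamma>..\<delta>}) g"
    by (rule ac_on_integrable_on[OF assms])
  fix x assume x: "\<gamma> \<le> x" "x \<le> \<delta>"
  have "integral {\<alpha>..\<gamma>} g + integral {\<gamma>..x} g = integral {\<alpha>..x} g"
    using assms x by (intro Henstock_Kurzweil_Integration.integral_combine ac_on_integrable_on(1)[OF assms(1)]) auto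
  then show "integral {\<gamma>..x} g = v x - v \<gamma>"
    using ac_on_eq[OF assms(1), of \<gamma>] ac_on_eq[OF assms(1), of x] assms x by simp
qed

lemma ac_on_DERIV:
  assumes "\<And>z. z \<in> {\<alpha>..\<beta>} \<Longrightarrow> (v has_real_derivative g z) (at z)" "continuous_on {\<alpha>..\<beta>} g"
  shows "ac_on \<alpha> \<beta> v g"
proof (rule ac_onI)
  show "integrable (lebesgue_on {\<alpha>..\<beta>}) g"
    by (rule continuous_imp_integrable_real[OF assms(2)])
  fix x assume x: "\<alpha> \<le> x" "x \<le> \<beta>"
  have "(g has_integral (v x - v \<alpha>)) {\<alpha>..x}"
    by (rule fundamental_theorem_of_calculus)
       (use assms(1) x in \<open>auto simp: has_real_derivative_iff_has_vector_derivative[symmetric]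
          intro: has_field_derivative_at_within\<close>)
  then show "integral {\<alpha>..x} g = v x - v \<alpha>"
    by (rule integral_unique)
qed

subsection \<open>Test functions\<close>

text \<open>
  The factor $s^{-n}$ makes the functions \<open>bump p q n\<close> below, polynomial multiples of
  \<open>flat n\<close> composed with a polynomial, closed under differentiation.
\<close>

definition flat :: "nat \<Rightarrow> real \<Rightarrow> real" where
  "flat n s = (if s > 0 then exp (- 1 / s) / s ^ n else 0)"

lemma flat_eq_mult: "flat n s = s * flat (Suc n) s"
  by (simp add: flat_def)

lemma flat_tendsto_0: "(flat n \<longlongrightarrow> 0) (at 0)"
proof (subst filterlim_at_split, intro conjI)
  have "eventually (\<lambda>s. flat n s = 0) (at_left 0)"
    by (auto simp: eventually_at_filter flat_def)
  then show "(flat n \<longlongrightarrow> 0) (at_left 0)"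
    by (rule tendsto_eventually)
  \<comment> \<open>Under \<open>s = 1 / x\<close> the limit from the right becomes that of
    \<open>x ^ n / exp x\<close> at infinity.\<close>
  have "eventually (\<lambda>x. x ^ n / exp x = flat n (inverse x)) at_top"
    using eventually_gt_at_top[of 0]
    by eventually_elim (simp add: flat_def exp_minus field_simps)
  then have "((\<lambda>x. flat n (inverse x)) \<longlongrightarrow> 0) at_top"
    by (rule Lim_transform_eventually[OF tendsto_power_div_exp_0])
  then show "(flat n \<longlongrightarrow> 0) (at_right 0)"
    by (simp add: filterlim_at_right_to_top)
qed

lemma flat_DERIV:
  "(flat n has_real_derivative flat (n + 2) s - real n * flat (n + 1) s) (at s)"
proof -
  consider "s > 0" | "s < 0" | "s = 0" by linarith
  then show ?thesis
  proof cases
    case 1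
    show ?thesis
    proof (rule has_field_derivative_transform_within_open[where S="{0<..}"])
      show "((\<lambda>s. exp (- 1 / s) / s ^ n) has_real_derivative flat (n + 2) s - real n * flat (n + 1) s) (at s)"
      proof (rule DERIV_cong)
        show "((\<lambda>s. exp (- 1 / s) / s ^ n) has_real_derivative
            (exp (- 1 / s) * (1 / s ^ 2) * s ^ n - exp (- 1 / s) * (real n * s ^ (n - 1))) / (s ^ n * s ^ n)) (at s)"
          using 1 by (auto intro!: derivative_eq_intros simp: power2_eq_square)
        show "(exp (- 1 / s) * (1 / s ^ 2) * s ^ n - exp (- 1 / s) * (real n * s ^ (n - 1))) / (s ^ n * s ^ n) =
            flat (n + 2) s - real n * flat (n + 1) s"
          using 1 by (cases n) (simp_all add: flat_def field_simps power2_eq_square)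
      qed
    qed (use 1 in \<open>auto simp: flat_def\<close>)
  next
    case 2
    show ?thesis
      by (rule has_field_derivative_transform_within_open[where S="{..<0}" and f="\<lambda>_. 0"])
         (use 2 in \<open>auto simp: flat_def\<close>)
  next
    case 3
    \<comment> \<open>The difference quotient of \<open>flat n\<close> at \<open>0\<close> is
      \<open>flat (Suc n)\<close>, whose limit is already known.\<close>
    have "((\<lambda>h. (flat n h - flat n 0) / (h - 0)) \<longlongrightarrow> 0) (at 0)"
    proof (rule Lim_transform_eventually[OF flat_tendsto_0[of "Suc n"]])
      show "\<forall>\<^sub>F h in at 0. flat (Suc n) h = (flat n h - flat n 0) / (h - 0)"
        by (auto simp: eventually_at_filter flat_def)
    qed
    then show ?thesis
      using 3 by (simp add: has_field_derivative_iff flat_def)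
  qed
qed

definition bump :: "real poly \<Rightarrow> real poly \<Rightarrow> nat \<Rightarrow> real \<Rightarrow> real" where
  "bump p q n x = poly q x * flat n (poly p x)"

text \<open>Chain and product rule produce \<open>flat\<close> at the indices \<open>n\<close>,
  \<open>n + 1\<close> and \<open>n + 2\<close>. By \<open>flat_eq_mult\<close> each step up in the
  index costs a factor \<open>poly p x\<close>, so everything collects in one polynomial in front of
  \<open>flat (n + 2)\<close>.\<close>

lemma bump_DERIV:
  "(bump p q n has_real_derivative
     bump p (pderiv q * p ^ 2 + q * pderiv p * (1 - of_nat n * p)) (n + 2) x) (at x)"
proof -
  have "flat (n + 1) s = s * flat (n + 2) s" "flat n s = s * (s * flat (n + 2) s)" for s
    using flat_eq_mult[of n s] flat_eq_mult[of "n + 1" s] by simp_all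
  note * = this[of "poly p x"]
  have "((\<lambda>x. flat n (poly p x)) has_real_derivative
      (flat (n + 2) (poly p x) - real n * flat (n + 1) (poly p x)) * poly (pderiv p) x) (at x)"
    by (rule DERIV_chain2[OF flat_DERIV poly_DERIV])
  from DERIV_mult[OF poly_DERIV this, of q]
  show ?thesis
    unfolding bump_def *(1) by (subst (asm) *(2)) (simp add: algebra_simps power2_eq_square)
qed

lemma higher_deriv_bump: "\<exists>q' m. (deriv ^^ k) (bump p q n) = bump p q' m"
proof (induction k)
  case (Suc k)
  then obtain q' m where "(deriv ^^ k) (bump p q n) = bump p q' m" by blast
  moreover have "deriv (bump p q' m) =
      bump p (pderiv q' * p ^ 2 + q' * pderiv p * (1 - of_nat m * p)) (m + 2)"
    by (intro ext DERIV_imp_deriv bump_DERIV)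
  ultimately show ?case by auto
qed auto

lemma bump_in_test_functions:
  assumes "compact {x. poly p x \<ge> 0}" "{x. poly p x \<ge> 0} \<subseteq> S"
  shows "bump p q n \<in> test_functions S"
proof -
  have "(deriv ^^ k) (bump p q n) differentiable (at z)" for k z
    using higher_deriv_bump[of k p q n] bump_DERIV real_differentiable_def by metis
  moreover have "bump p q n z = 0" if "z \<notin> {x. poly p x \<ge> 0}" for z
    using that by (simp add: bump_def flat_def)
  ultimately show ?thesis
    using assms by (auto simp: test_functions_def)
qed

lemma test_function_DERIV:
  assumes "\<phi> \<in> test_functions S"
  shows "((deriv ^^ n) \<phi> has_real_derivative (deriv ^^ Suc n) \<phi> z) (at z)"
  using assms DERIV_deriv_iff_real_differentiable[of "(deriv ^^ n) \<phi>"]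
  by (auto simp: test_functions_def)

lemma test_function_support:
  assumes "\<phi> \<in> test_functions {\<alpha><..<\<beta>}" "\<alpha> < \<beta>"
  obtains \<gamma> \<delta> where "\<alpha> < \<gamma>" "\<gamma> \<le> \<delta>" "\<delta> < \<beta>" "\<And>z. z \<notin> {\<gamma>..\<delta>} \<Longrightarrow> \<phi> z = 0"
proof -
  obtain K where K: "compact K" "K \<subseteq> {\<alpha><..<\<beta>}" "\<And>z. z \<notin> K \<Longrightarrow> \<phi> z = 0"
    using assms(1) by (auto simp: test_functions_def)
  show thesis
  proof (cases "K = {}")
    case True
    \<comment> \<open>Here \<open>\<phi>\<close> is identically zero, and the midpoint serves as a
      degenerate interval.\<close>
    with K(3) \<open>\<alpha> < \<beta>\<close> show thesis
      by (intro that[of "(\<alpha> + \<beta>) / 2" "(\<alpha> + \<beta>) / 2"]) auto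
  next
    case False
    obtain \<gamma> \<delta> where *: "\<gamma> \<in> K" "\<forall>z\<in>K. \<gamma> \<le> z" "\<delta> \<in> K" "\<forall>z\<in>K. z \<le> \<delta>"
      using compact_attains_inf[OF K(1) False] compact_attains_sup[OF K(1) False] by blast
    show thesis
    proof (rule that[of \<gamma> \<delta>])
      show "\<alpha> < \<gamma>" "\<gamma> \<le> \<delta>" "\<delta> < \<beta>" using * K(2) by auto
      show "\<phi> z = 0" if "z \<notin> {\<gamma>..\<delta>}" for z
        using that * K(3)[of z] by auto
    qed
  qed
qed

lemma test_function_ac:
  assumes "\<phi> \<in> test_functions S"
  shows "ac_on \<alpha> \<beta> \<phi> (deriv \<phi>)"
proof (rule ac_on_DERIV)
  show "(\<phi> has_real_derivative deriv \<phi> z) (at z)" for z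
    using test_function_DERIV[OF assms, of 0] by simp
  have "isCont (deriv \<phi>) z" for z
    using test_function_DERIV[OF assms, of 1 z] by (simp add: DERIV_isCont)
  then show "continuous_on {\<alpha>..\<beta>} (deriv \<phi>)"
    by (simp add: continuous_at_imp_continuous_on)
qed

lemma test_function_continuous:
  assumes "\<phi> \<in> test_functions S"
  shows "continuous_on T \<phi>"
  using test_function_DERIV[OF assms, of 0] by (auto intro!: continuous_at_imp_continuous_on DERIV_isCont)

lemma test_function_lincomb:
  assumes "\<phi> \<in> test_functions S" "\<psi> \<in> test_functions S"
  shows "(\<lambda>z. c * \<phi> z - d * \<psi> z) \<in> test_functions S"
proof -
  note D = test_function_DERIV[OF assms(1)] test_function_DERIV[OF assms(2)]
  have *: "(deriv ^^ n) (\<lambda>z. c * \<phi> z - d * \<psi> z) = (\<lambda>z. c * (deriv ^^ n) \<phi> z - d * (deriv ^^ n) \<psi> z)" for n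
  proof (induction n)
    case (Suc n)
    have "deriv (\<lambda>z. c * (deriv ^^ n) \<phi> z - d * (deriv ^^ n) \<psi> z) z =
        c * (deriv ^^ Suc n) \<phi> z - d * (deriv ^^ Suc n) \<psi> z" for z
      by (intro DERIV_imp_deriv DERIV_diff[OF DERIV_cmult[OF D(1)] DERIV_cmult[OF D(2)]])
    with Suc show ?case by auto
  qed simp
  have "(deriv ^^ n) (\<lambda>z. c * \<phi> z - d * \<psi> z) differentiable (at z)" for n z
    unfolding * real_differentiable_def
    using DERIV_diff[OF DERIV_cmult[OF D(1)[of n z]] DERIV_cmult[OF D(2)[of n z]]] by blast
  moreover obtain K L where "compact K" "K \<subseteq> S" "\<forall>z. z \<notin> K \<longrightarrow> \<phi> z = 0"
      "compact L" "L \<subseteq> S" "\<forall>z. z \<notin> L \<longrightarrow> \<psi> z = 0"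
    using assms unfolding test_functions_def by blast
  then have "compact (K \<union> L) \<and> K \<union> L \<subseteq> S \<and> (\<forall>z. z \<notin> K \<union> L \<longrightarrow> c * \<phi> z - d * \<psi> z = 0)"
    by auto
  ultimately show ?thesis
    unfolding test_functions_def by blast
qed

text \<open>The primitive from \<open>\<alpha>\<close> is constant to the right of the support of
  \<open>\<xi>\<close>, and the constant is the total integral. Mean zero makes it vanish there, so
  the primitive has compact support again.\<close>

lemma test_function_antiderivative:
  assumes \<xi>: "\<xi> \<in> test_functions {\<alpha><..<\<beta>}" and "\<alpha> < \<beta>" and 0: "integral {\<alpha>..\<beta>} \<xi> = 0"
  obtains \<phi> where "\<phi> \<in> test_functions {\<alpha><..<\<beta>}" "deriv \<phi> = \<xi>"
proof -
  obtain \<gamma> \<delta> where \<gamma>\<delta>: "\<alpha> < \<gamma>" "\<gamma> \<le> \<delta>" "\<delta> < \<beta>" and supp: "\<And>z. z \<notin> {\<gamma>..\<delta>} \<Longrightarrow> \<xi> z = 0"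
    using test_function_support[OF \<xi> \<open>\<alpha> < \<beta>\<close>] by blast
  have int: "\<xi> integrable_on {c..d}" for c d
    by (intro integrable_continuous_real test_function_continuous[OF \<xi>])
  define \<phi> where "\<phi> = (\<lambda>x. integral {\<alpha>..x} \<xi>)"
  have left: "\<phi> x = 0" if "x < \<gamma>" for x
    unfolding \<phi>_def by (subst integral_cong[where g="\<lambda>_. 0"]) (use supp that in auto)
  have zero: "integral {\<delta>..x} \<xi> = 0" if "\<delta> \<le> x" for x
  proof -
    have "integral {\<delta>..x} \<xi> = integral {\<delta>..x} (\<lambda>_. 0)"
      by (rule integral_spike[of "{\<delta>}"]) (use supp in auto)
    then show ?thesis by simp
  qed
  have right: "\<phi> x = 0" if "\<delta> < x" for x
    using Henstock_Kurzweil_Integration.integral_combine[of \<alpha> \<delta> x \<xi>]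
      Henstock_Kurzweil_Integration.integral_combine[of \<alpha> \<delta> \<beta> \<xi>] zero[of x] zero[of \<beta>]
      int 0 \<gamma>\<delta> that by (simp add: \<phi>_def)
  have D: "(\<phi> has_real_derivative \<xi> x) (at x)" for x
  proof (cases "x < \<gamma>")
    case True
    show ?thesis
      by (rule has_field_derivative_transform_within_open[where S="{..<\<gamma>}" and f="\<lambda>_. 0"])
         (use True left supp[of x] in auto)
  next
    case False
    have "(\<phi> has_real_derivative \<xi> x) (at x within {\<alpha>..x + 1})"
      unfolding \<phi>_def using False \<gamma>\<delta>
      by (intro integral_has_real_derivative test_function_continuous[OF \<xi>]) auto
    then show ?thesis
      using False \<gamma>\<delta> at_within_interior[of x "{\<alpha>..x + 1}"] by simp
  qed
  then have d: "deriv \<phi> = \<xi>" by (auto intro: DERIV_imp_deriv)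
  have "(deriv ^^ n) \<phi> differentiable (at z)" for n z
  proof (cases n)
    case 0
    then show ?thesis using D by (auto simp: real_differentiable_def)
  next
    case (Suc m)
    have "(deriv ^^ n) \<phi> = (deriv ^^ m) \<xi>" unfolding Suc funpow_Suc_right comp_def d ..
    then show ?thesis using \<xi> by (auto simp: test_functions_def)
  qed
  moreover have "\<phi> z = 0" if "z \<notin> {\<gamma>..\<delta>}" for z
    using left right that by force
  ultimately have "\<phi> \<in> test_functions {\<alpha><..<\<beta>}"
    unfolding test_functions_def using \<gamma>\<delta>
    by (intro CollectI conjI exI[of _ "{\<gamma>..\<delta>}"]) auto
  with d that show thesis by blast
qed

text \<open>Inside \<open>(c, d)\<close> this is \<open>exp (- 1 / s)\<close> with
  \<open>s = (k + 1) * ((x - c) * (d - x))\<close>, which tends to 1 with growing \<open>k\<close>: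
  a smooth approximation of the indicator of the interval. \<open>Suc\<close> makes index 0 a
  genuine bump already.\<close>

definition plateau :: "real \<Rightarrow> real \<Rightarrow> nat \<Rightarrow> real \<Rightarrow> real" where
  "plateau c d k x = flat 0 (real (Suc k) * ((x - c) * (d - x)))"

lemma plateau_test_function:
  assumes "\<alpha> < c" "c < d" "d < \<beta>"
  shows "plateau c d k \<in> test_functions {\<alpha><..<\<beta>}"
proof -
  define p where "p = smult (real (Suc k)) ([:- c, 1:] * [:d, -1:])"
  have p: "poly p x = real (Suc k) * ((x - c) * (d - x))" for x
    by (simp add: p_def algebra_simps)
  have "{x. poly p x \<ge> 0} = {c..d}"
    using assms by (auto simp: p zero_le_mult_iff)
  then have "bump p 1 0 \<in> test_functions {\<alpha><..<\<beta>}"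
    using assms by (intro bump_in_test_functions) auto
  moreover have "bump p 1 0 = plateau c d k"
    by (auto simp: bump_def plateau_def p)
  ultimately show ?thesis by simp
qed

lemma plateau_bounds: "0 \<le> plateau c d k x" "plateau c d k x \<le> 1"
  by (auto simp: plateau_def flat_def divide_le_0_iff)

lemma plateau_tendsto:
  assumes "c < d"
  shows "(\<lambda>k. plateau c d k x) \<longlonglongrightarrow> indicator {c<..<d} x"
proof (cases "x \<in> {c<..<d}")
  case True
  define s where "s = (x - c) * (d - x)"
  have "s > 0" using True by (simp add: s_def)
  have "(\<lambda>k. exp (- (inverse (real (Suc k)) * inverse s))) \<longlonglongrightarrow> exp (- (0 * inverse s))"
    by (intro tendsto_intros LIMSEQ_inverse_real_of_nat)
  moreover have "plateau c d k x = exp (- (inverse (real (Suc k)) * inverse s))" for k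
    using \<open>s > 0\<close> unfolding plateau_def s_def[symmetric]
    by (simp add: flat_def field_simps del: of_nat_Suc)
  ultimately show ?thesis using True by simp
next
  case False
  then have "(x - c) * (d - x) \<le> 0"
    using \<open>c < d\<close> by (cases "x \<le> c") (auto intro: mult_nonpos_nonneg mult_nonneg_nonpos)
  then have "real (Suc k) * ((x - c) * (d - x)) \<le> 0" for k
    by (rule mult_nonneg_nonpos[OF of_nat_0_le_iff])
  then have "plateau c d k x = 0" for k
    unfolding plateau_def flat_def by (simp only: not_less[symmetric] if_False)
  then show ?thesis using False by simp
qed

text \<open>The functions \<open>plateau\<close> approximate indicators, so by dominated convergence
  \<open>u\<close> has integral zero over every compact subinterval; Lebesgue differentiation turns
  this into \<open>u = 0\<close> almost everywhere.\<close>

lemma fundamental_lemma: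
  assumes u: "integrable (lebesgue_on {\<alpha><..<\<beta>}) u"
    and 0: "\<And>\<phi>. \<phi> \<in> test_functions {\<alpha><..<\<beta>} \<Longrightarrow> (LINT z|lebesgue_on {\<alpha><..<\<beta>}. u z * \<phi> z) = 0"
  shows "AE z in lebesgue_on {\<alpha><..<\<beta>}. u z = (0::real)"
proof -
  let ?M = "lebesgue_on {\<alpha><..<\<beta>}"
  have int0: "integral {c..d} u = 0" if "\<alpha> < c" "c < d" "d < \<beta>" for c d
  proof -
    have "(\<lambda>k. LINT z|?M. u z * plateau c d k z) \<longlonglongrightarrow> (LINT z|?M. u z * indicator {c<..<d} z)"
    proof (rule integral_dominated_convergence)
      show "integrable ?M (\<lambda>z. norm (u z))" using u by simp
      show "(\<lambda>z. u z * indicator {c<..<d} z) \<in> borel_measurable ?M"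
        by (intro borel_measurable_times[OF borel_measurable_integrable[OF u]] measurable_restrict_space1
            borel_measurable_indicator) simp
      show "(\<lambda>z. u z * plateau c d k z) \<in> borel_measurable ?M" for k
        by (intro borel_measurable_times[OF borel_measurable_integrable[OF u]]
            continuous_imp_measurable_on_sets_lebesgue
            test_function_continuous[OF plateau_test_function[OF that]]) simp
      show "AE z in ?M. (\<lambda>k. u z * plateau c d k z) \<longlonglongrightarrow> u z * indicator {c<..<d} z"
        by (intro AE_I2 tendsto_intros plateau_tendsto that)
      show "AE z in ?M. norm (u z * plateau c d k z) \<le> norm (u z)" for k
        using plateau_bounds[of c d k] by (intro AE_I2) (auto simp: abs_mult intro!: mult_left_le)
    qed
    then have "(LINT z|?M. u z * indicator {c<..<d} z) = 0"
      by (simp add: 0[OF plateau_test_function[OF that]] LIMSEQ_const_iff)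
    moreover have "(LINT z|?M. u z * indicator {c<..<d} z) = (LINT z|lebesgue_on {c<..<d}. u z)"
    proof -
      have "(LINT z|?M. u z * indicator {c<..<d} z) =
          (LINT z|lebesgue. indicator {\<alpha><..<\<beta>} z * (u z * indicator {c<..<d} z))"
        by (simp add: integral_restrict_space)
      also have "\<dots> = (LINT z|lebesgue. indicator {c<..<d} z * u z)"
        using that by (intro Bochner_Integration.integral_cong) (auto simp: indicator_def)
      also have "\<dots> = (LINT z|lebesgue_on {c<..<d}. u z)"
        by (simp add: integral_restrict_space)
      finally show ?thesis .
    qed
    moreover have "integrable (lebesgue_on {c<..<d}) u"
      by (rule integrable_lebesgue_on_subset[OF u]) (use that in auto)
    ultimately show ?thesis
      by (simp add: lebesgue_integral_eq_integral integral_open_interval_real)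
  qed
  define f where "f = (\<lambda>z. if z \<in> {\<alpha><..<\<beta>} then u z else 0)"
  have "u integrable_on {\<alpha><..<\<beta>}" using u by (rule integrable_on_lebesgue_on) simp
  then have "f integrable_on UNIV" unfolding f_def by (simp only: integrable_restrict_UNIV)
  then have "f integrable_on cbox c d" for c d
    by (rule integrable_on_subcbox) (rule subset_UNIV)
  \<comment> \<open>Lebesgue's differentiation theorem on the whole line, hence the extension
    \<open>f\<close> by zero: off a null set, the averages over \<open>[x, x + h]\<close> converge
    to the value at \<open>x\<close>.\<close>
  then obtain N where "negligible N" and N: "\<And>x e. \<lbrakk>x \<notin> N; 0 < e\<rbrakk> \<Longrightarrow>
      \<exists>d>0. \<forall>h. 0 < h \<and> h < d \<longrightarrow> norm (integral (cbox x (x + h *\<^sub>R One)) f /\<^sub>R h ^ DIM(real) - f x) < e"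
    using integrable_ccontinuous_explicit[of f] by metis
  have "u x = 0" if x: "x \<in> {\<alpha><..<\<beta>}" "x \<notin> N" for x
  proof (rule ccontr)
    assume "u x \<noteq> 0"
    then obtain d where "d > 0" and
      d: "\<And>h. 0 < h \<Longrightarrow> h < d \<Longrightarrow> norm (integral {x..x + h} f /\<^sub>R h - f x) < \<bar>u x\<bar>"
      using N[OF x(2), of "\<bar>u x\<bar>"] by auto
    \<comment> \<open>Halving keeps \<open>[x, x + h]\<close> strictly inside the interval, where
      \<open>int0\<close> applies.\<close>
    define h where "h = min d (\<beta> - x) / 2"
    have h: "0 < h" "h < d" "x + h < \<beta>" using x \<open>d > 0\<close> by (auto simp: h_def min_def field_simps)
    have "integral {x..x + h} f = integral {x..x + h} u"
      by (rule integral_cong) (use x h in \<open>auto simp: f_def\<close>)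
    also have "\<dots> = 0" using int0[of x "x + h"] x h by simp
    finally show False using d[OF h(1,2)] x by (simp add: f_def)
  qed
  then have "AE x in lebesgue. x \<in> {\<alpha><..<\<beta>} \<longrightarrow> u x = 0"
    using \<open>negligible N\<close> by (intro AE_I'[of N]) (auto simp: negligible_iff_null_sets)
  then show ?thesis by (simp add: AE_restrict_space_iff)
qed

subsection \<open>Weak derivatives and continuous representatives\<close>

lemma integrable_mult_test_function:
  fixes u \<phi> :: "real \<Rightarrow> real"
  assumes "integrable (lebesgue_on {\<alpha><..<\<beta>}) u" "continuous_on UNIV \<phi>"
  shows "integrable (lebesgue_on {\<alpha><..<\<beta>}) (\<lambda>z. u z * \<phi> z)"
  using integrable_continuous_mult[of \<alpha> \<beta> \<phi> u] continuous_on_subset[OF assms(2)] assms(1)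
  by (simp add: integrable_Icc_iff_Ioo mult.commute)

lemma test_function_deriv_continuous:
  assumes "\<phi> \<in> test_functions S"
  shows "continuous_on T (deriv \<phi>)"
  using test_function_DERIV[OF assms, of 1]
  by (auto intro!: continuous_at_imp_continuous_on DERIV_isCont)

lemma LINT_continuous_eq_integral:
  fixes \<phi> :: "real \<Rightarrow> real"
  assumes "continuous_on UNIV \<phi>"
  shows "(LINT z|lebesgue_on {\<alpha><..<\<beta>}. \<phi> z) = integral {\<alpha>..\<beta>} \<phi>"
  using continuous_imp_integrable_real[OF continuous_on_subset[OF assms subset_UNIV], of \<alpha> \<beta>]
  by (simp add: LINT_Icc_eq_Ioo[symmetric] lebesgue_integral_eq_integral)

text \<open>Every test function of mean zero is the derivative of a test function. Any
  \<open>\<psi>\<close> becomes one, up to scaling, after subtracting a multiple of a fixed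
  \<open>\<eta>\<close> with nonzero integral; so \<open>u\<close> acts on all test functions as a
  constant does, namely as its \<open>\<eta>\<close>-weighted average.\<close>

lemma du_Bois_Reymond:
  assumes u: "integrable (lebesgue_on {\<alpha><..<\<beta>}) u" and "\<alpha> < \<beta>"
    and 0: "\<And>\<phi>. \<phi> \<in> test_functions {\<alpha><..<\<beta>} \<Longrightarrow> (LINT z|lebesgue_on {\<alpha><..<\<beta>}. u z * deriv \<phi> z) = 0"
  obtains c :: real where "AE z in lebesgue_on {\<alpha><..<\<beta>}. u z = c"
proof -
  let ?M = "lebesgue_on {\<alpha><..<\<beta>}"
  define \<eta> where "\<eta> = plateau ((2 * \<alpha> + \<beta>) / 3) ((\<alpha> + 2 * \<beta>) / 3) 0"
  have \<eta>: "\<eta> \<in> test_functions {\<alpha><..<\<beta>}"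
    unfolding \<eta>_def using \<open>\<alpha> < \<beta>\<close> by (intro plateau_test_function) (auto simp: field_simps)
  define m where "m = integral {\<alpha>..\<beta>} \<eta>"
  define c where "c = (LINT z|?M. u z * \<eta> z) / m"
  have "m \<noteq> 0"
  proof
    assume "m = 0"
    moreover have "\<eta> ((\<alpha> + \<beta>) / 2) \<noteq> 0"
      using \<open>\<alpha> < \<beta>\<close> by (simp add: \<eta>_def plateau_def flat_def zero_less_mult_iff)
    moreover have "(\<alpha> + \<beta>) / 2 \<in> {\<alpha>..\<beta>}" using \<open>\<alpha> < \<beta>\<close> by simp
    ultimately show False
      using integral_eq_0_iff[OF test_function_continuous[OF \<eta>], of \<alpha> \<beta>] plateau_bounds(1) \<open>\<alpha> < \<beta>\<close>
      unfolding m_def \<eta>_def by blast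
  qed
  have i1: "integrable ?M (\<lambda>z. u z * \<phi> z)" if "\<phi> \<in> test_functions {\<alpha><..<\<beta>}" for \<phi>
    by (rule integrable_mult_test_function[OF u test_function_continuous[OF that]])
  have i2: "\<phi> integrable_on {\<alpha>..\<beta>}" if "\<phi> \<in> test_functions {\<alpha><..<\<beta>}" for \<phi>
    by (intro integrable_continuous_real test_function_continuous[OF that])
  have "AE z in ?M. u z - c = 0"
  proof (rule fundamental_lemma)
    show "integrable ?M (\<lambda>z. u z - c)"
      using u integrable_Icc_iff_Ioo[of \<alpha> \<beta> "\<lambda>_. c"] by simp
    fix \<psi> assume \<psi>: "\<psi> \<in> test_functions {\<alpha><..<\<beta>}"
    define k where "k = integral {\<alpha>..\<beta>} \<psi>"
    have \<xi>: "(\<lambda>z. m * \<psi> z - k * \<eta> z) \<in> test_functions {\<alpha><..<\<beta>}"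
      by (rule test_function_lincomb[OF \<psi> \<eta>])
    moreover have "integral {\<alpha>..\<beta>} (\<lambda>z. m * \<psi> z - k * \<eta> z) = 0"
      using i2[OF \<psi>] i2[OF \<eta>]
      by (subst Henstock_Kurzweil_Integration.integral_diff)
         (auto simp: m_def k_def intro: integrable_on_mult_right)
    ultimately obtain \<phi> where "\<phi> \<in> test_functions {\<alpha><..<\<beta>}" "deriv \<phi> = (\<lambda>z. m * \<psi> z - k * \<eta> z)"
      using test_function_antiderivative \<open>\<alpha> < \<beta>\<close> by blast
    with 0 have "0 = (LINT z|?M. u z * (m * \<psi> z - k * \<eta> z))" by metis
    also have "\<dots> = (LINT z|?M. m * (u z * \<psi> z) - k * (u z * \<eta> z))"
      by (simp add: algebra_simps)
    also have "\<dots> = m * (LINT z|?M. u z * \<psi> z) - k * (LINT z|?M. u z * \<eta> z)"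
      using i1[OF \<psi>] i1[OF \<eta>] by simp
    finally have *: "(LINT z|?M. u z * \<psi> z) = k * c"
      using \<open>m \<noteq> 0\<close> by (simp add: c_def field_simps)
    have "(LINT z|?M. (u z - c) * \<psi> z) = (LINT z|?M. u z * \<psi> z - c * \<psi> z)"
      by (simp add: algebra_simps)
    also have "\<dots> = (LINT z|?M. u z * \<psi> z) - c * (LINT z|?M. \<psi> z)"
      using i1[OF \<psi>] continuous_imp_integrable_real[OF test_function_continuous[OF \<psi>], of \<alpha> \<beta>]
      by (simp add: integrable_Icc_iff_Ioo)
    also have "\<dots> = 0"
      using * by (simp add: k_def LINT_continuous_eq_integral[OF test_function_continuous[OF \<psi>]])
    finally show "(LINT z|?M. (u z - c) * \<psi> z) = 0" .
  qed
  then have "AE z in ?M. u z = c" by simp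
  then show thesis by (rule that)
qed

lemma ac_on_continuous_Ioo:
  assumes "ac_on \<alpha> \<beta> v g"
  shows "continuous_on {\<alpha><..<\<beta>} v"
  by (rule continuous_on_subset[OF ac_on_continuous[OF assms]]) auto

text \<open>\<open>u\<close> is an arbitrary representative of its class, \<open>v\<close> the
  absolutely continuous one, given up to the endpoints, and \<open>g\<close> the derivative. The
  endpoint values of \<open>v\<close> are the traces of \<open>u\<close>.\<close>

definition ac_rep :: "real \<Rightarrow> real \<Rightarrow> (real \<Rightarrow> real) \<Rightarrow> (real \<Rightarrow> real) \<Rightarrow> (real \<Rightarrow> real) \<Rightarrow> bool" where
  "ac_rep \<alpha> \<beta> u v g \<longleftrightarrow> ac_on \<alpha> \<beta> v g \<and> (AE z in lebesgue_on {\<alpha><..<\<beta>}. v z = u z)"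

text \<open>A test function vanishes at both endpoints, so integration by parts against it leaves no
  boundary term.\<close>

lemma ac_rep_imp_weak_deriv:
  assumes "ac_rep \<alpha> \<beta> u v g" "\<alpha> < \<beta>" "u \<in> borel_measurable (lebesgue_on {\<alpha><..<\<beta>})"
  shows "is_weak_deriv {\<alpha><..<\<beta>} u g"
  unfolding is_weak_deriv_def dist_deriv_def
proof
  fix \<phi> assume \<phi>: "\<phi> \<in> test_functions {\<alpha><..<\<beta>}"
  have ac: "ac_on \<alpha> \<beta> v g" and eq: "AE z in lebesgue_on {\<alpha><..<\<beta>}. v z = u z"
    using assms(1) by (auto simp: ac_rep_def)
  have "\<phi> \<alpha> = 0" "\<phi> \<beta> = 0"
    using test_function_support[OF \<phi> assms(2)] by (metis atLeastAtMost_iff not_le)+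
  then have ibp: "(LINT z|lebesgue_on {\<alpha>..\<beta>}. v z * deriv \<phi> z) + (LINT z|lebesgue_on {\<alpha>..\<beta>}. \<phi> z * g z) = 0"
    using ac_on_integration_by_parts(3)[OF ac test_function_ac[OF \<phi>]] assms(2) by simp
  have m: "deriv \<phi> \<in> borel_measurable (lebesgue_on {\<alpha><..<\<beta>})"
    by (intro continuous_imp_measurable_on_sets_lebesgue test_function_deriv_continuous[OF \<phi>]) simp
  have mv: "v \<in> borel_measurable (lebesgue_on {\<alpha><..<\<beta>})"
    by (rule continuous_imp_measurable_on_sets_lebesgue[OF ac_on_continuous_Ioo[OF ac]]) simp
  have "(LINT z|lebesgue_on {\<alpha><..<\<beta>}. u z * deriv \<phi> z) = (LINT z|lebesgue_on {\<alpha><..<\<beta>}. v z * deriv \<phi> z)"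
    by (rule integral_cong_AE)
       (use m mv assms(3) eq in \<open>auto intro!: borel_measurable_times elim: eventually_mono\<close>)
  then show "(LINT z|lebesgue_on {\<alpha><..<\<beta>}. g z * \<phi> z) = - (LINT z|lebesgue_on {\<alpha><..<\<beta>}. u z * deriv \<phi> z)"
    using ibp by (simp add: LINT_Icc_eq_Ioo mult.commute)
qed

text \<open>The indefinite integral of \<open>g\<close> has the same weak derivative as
  \<open>u\<close>. By \<open>du_Bois_Reymond\<close> the two differ by a constant, and adding it
  gives the representative.\<close>

lemma weak_deriv_imp_ac_rep:
  assumes "is_weak_deriv {\<alpha><..<\<beta>} u g" "\<alpha> < \<beta>"
    and u: "integrable (lebesgue_on {\<alpha><..<\<beta>}) u" and g: "integrable (lebesgue_on {\<alpha><..<\<beta>}) g"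
  obtains v where "ac_rep \<alpha> \<beta> u v g"
proof -
  let ?M = "lebesgue_on {\<alpha><..<\<beta>}"
  define w where "w = (\<lambda>x. integral {\<alpha>..x} g)"
  have w: "ac_on \<alpha> \<beta> w g"
    by (rule ac_onI) (use g in \<open>simp_all add: w_def integrable_Icc_iff_Ioo\<close>)
  have iw: "integrable ?M w"
    using continuous_imp_integrable_real[OF ac_on_continuous[OF w]] by (simp add: integrable_Icc_iff_Ioo)
  have mw: "w \<in> borel_measurable ?M" using iw by simp
  have wd: "is_weak_deriv {\<alpha><..<\<beta>} w g"
    by (rule ac_rep_imp_weak_deriv[OF _ assms(2) mw, where v=w]) (simp add: ac_rep_def w)
  obtain c where c: "AE z in ?M. u z - w z = c"
  proof (rule du_Bois_Reymond[OF _ \<open>\<alpha> < \<beta>\<close>, of "\<lambda>z. u z - w z"])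
    show "integrable ?M (\<lambda>z. u z - w z)" using u iw by simp
    fix \<phi> assume \<phi>: "\<phi> \<in> test_functions {\<alpha><..<\<beta>}"
    have "(LINT z|?M. u z * deriv \<phi> z) = (LINT z|?M. w z * deriv \<phi> z)"
      using assms(1) wd \<phi> by (simp add: is_weak_deriv_def dist_deriv_def)
    then show "(LINT z|?M. (u z - w z) * deriv \<phi> z) = 0"
      using integrable_mult_test_function[OF u test_function_deriv_continuous[OF \<phi>]]
        integrable_mult_test_function[OF iw test_function_deriv_continuous[OF \<phi>]]
      by (simp add: left_diff_distrib)
  qed
  have "ac_on \<alpha> \<beta> (\<lambda>z. c + w z) g"
    by (rule ac_onI) (simp_all add: ac_on_integrable[OF w] ac_on_eq[OF w])
  moreover have "AE z in ?M. c + w z = u z"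
    using c by eventually_elim simp
  ultimately show thesis using that by (auto simp: ac_rep_def)
qed

lemma weak_deriv_unique:
  assumes "is_weak_deriv {\<alpha><..<\<beta>} u g" "is_weak_deriv {\<alpha><..<\<beta>} u h"
    and g: "integrable (lebesgue_on {\<alpha><..<\<beta>}) g" and h: "integrable (lebesgue_on {\<alpha><..<\<beta>}) h"
  shows "AE z in lebesgue_on {\<alpha><..<\<beta>}. g z = h z"
proof -
  have "AE z in lebesgue_on {\<alpha><..<\<beta>}. g z - h z = 0"
  proof (rule fundamental_lemma)
    fix \<phi> assume \<phi>: "\<phi> \<in> test_functions {\<alpha><..<\<beta>}"
    show "(LINT z|lebesgue_on {\<alpha><..<\<beta>}. (g z - h z) * \<phi> z) = 0"
      using integrable_mult_test_function[OF g test_function_continuous[OF \<phi>]]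
        integrable_mult_test_function[OF h test_function_continuous[OF \<phi>]] assms(1,2) \<phi>
      by (simp add: left_diff_distrib is_weak_deriv_def)
  qed (use g h in simp)
  then show ?thesis by simp
qed

lemma H1_ac_rep:
  assumes "u \<in> H1 {\<alpha><..<\<beta>}" "\<alpha> < \<beta>"
  obtains v g where "ac_rep \<alpha> \<beta> u v g" "g \<in> L2 {\<alpha>..\<beta>}"
proof -
  obtain g where g: "g \<in> L2 {\<alpha><..<\<beta>}" "is_weak_deriv {\<alpha><..<\<beta>} u g" and u: "u \<in> L2 {\<alpha><..<\<beta>}"
    using assms(1) by (auto simp: H1_def)
  obtain v where "ac_rep \<alpha> \<beta> u v g"
    using weak_deriv_imp_ac_rep[OF g(2) assms(2)] integrable_L2 u g(1) by (metis lmeasurable_interval(2))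
  with that g(1) show thesis by (simp add: L2_Icc_iff_Ioo)
qed

lemma ac_rep_H1:
  assumes "ac_rep \<alpha> \<beta> u v g" "\<alpha> < \<beta>" "g \<in> L2 {\<alpha>..\<beta>}"
  shows "u \<in> H1 {\<alpha><..<\<beta>}"
proof -
  have v: "v \<in> L2 {\<alpha><..<\<beta>}"
    unfolding L2_Icc_iff_Ioo[symmetric]
    by (rule L2_continuous[OF ac_on_continuous[of _ _ _ g]]) (use assms(1) in \<open>simp add: ac_rep_def\<close>)
  have u: "u \<in> L2 {\<alpha><..<\<beta>}"
    by (rule L2_cong_AE[OF v]) (use assms(1) in \<open>auto simp: ac_rep_def\<close>)
  moreover have "is_weak_deriv {\<alpha><..<\<beta>} u g"
    by (rule ac_rep_imp_weak_deriv[OF assms(1,2) L2_D(1)[OF u]])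
  ultimately show ?thesis using assms(3) by (auto simp: H1_def L2_Icc_iff_Ioo)
qed

text \<open>The set of disagreement is open, and a nonempty open set is not null.\<close>

lemma continuous_eq_of_AE_eq:
  fixes v w :: "real \<Rightarrow> real"
  assumes "continuous_on S v" "continuous_on S w" "open S"
    and "AE z in lebesgue_on S. v z = w z" "x \<in> S"
  shows "v x = w x"
proof (rule ccontr)
  assume neq: "v x \<noteq> w x"
  let ?U = "S \<inter> (\<lambda>z. v z - w z) -` (- {0})"
  have "open ?U"
    by (rule continuous_open_preimage[OF _ assms(3)]) (auto intro!: continuous_intros assms(1,2))
  moreover have "x \<in> ?U" using neq assms(5) by simp
  ultimately have "\<not> negligible ?U" using open_not_negligible[of ?U] by blast
  moreover have "AE z in lebesgue. z \<notin> ?U"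
    using assms(3,4) by (auto simp: AE_restrict_space_iff elim: eventually_mono)
  then have "negligible ?U"
    by (simp add: negligible_iff_null_sets completion.null_sets_iff_AE)
  ultimately show False by blast
qed

text \<open>The property that selects \<open>cont_rep\<close> determines it on the open interval, so
  the choice can be traded for any representative at hand.\<close>

lemma cont_rep_eq:
  assumes "ac_rep \<alpha> \<beta> u v g" "x \<in> {\<alpha><..<\<beta>}"
  shows "cont_rep {\<alpha><..<\<beta>} u x = v x"
proof -
  let ?P = "\<lambda>w. continuous_on {\<alpha><..<\<beta>} w \<and> (AE z in lebesgue_on {\<alpha><..<\<beta>}. w z = u z)"
  have v: "?P v"
    using assms(1) ac_on_continuous_Ioo by (auto simp: ac_rep_def)
  then have c: "?P (cont_rep {\<alpha><..<\<beta>} u)"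
    unfolding cont_rep_def by (rule someI[of ?P])
  have "AE z in lebesgue_on {\<alpha><..<\<beta>}. cont_rep {\<alpha><..<\<beta>} u z = v z"
    using conjunct2[OF c] conjunct2[OF v] by eventually_elim simp
  then show ?thesis
    using continuous_eq_of_AE_eq[of "{\<alpha><..<\<beta>}" "cont_rep {\<alpha><..<\<beta>} u" v x] c v assms(2) by simp
qed

text \<open>One-sided limits see \<open>cont_rep\<close> only inside the interval, where it equals
  \<open>v\<close>, and \<open>v\<close> is continuous up to the endpoints.\<close>

lemma trace_eq:
  assumes "ac_rep \<alpha> \<beta> u v g" "\<alpha> < \<beta>"
  shows "trace_left {\<alpha><..<\<beta>} u \<beta> = v \<beta>" "trace_right {\<alpha><..<\<beta>} u \<alpha> = v \<alpha>"
proof -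
  have "continuous_on {\<alpha>..\<beta>} v"
    using assms(1) ac_on_continuous by (auto simp: ac_rep_def)
  then have "(v \<longlongrightarrow> v \<beta>) (at_left \<beta>)" "(v \<longlongrightarrow> v \<alpha>) (at_right \<alpha>)"
    using assms(2) by (auto simp: continuous_on_Icc_at_leftD continuous_on_Icc_at_rightD)
  moreover have "\<forall>\<^sub>F x in at_left \<beta>. v x = cont_rep {\<alpha><..<\<beta>} u x"
    using eventually_at_left_real[OF assms(2)] by eventually_elim (simp add: cont_rep_eq[OF assms(1)])
  moreover have "\<forall>\<^sub>F x in at_right \<alpha>. v x = cont_rep {\<alpha><..<\<beta>} u x"
    using eventually_at_right_real[OF assms(2)] by eventually_elim (simp add: cont_rep_eq[OF assms(1)])
  ultimately have "(cont_rep {\<alpha><..<\<beta>} u \<longlongrightarrow> v \<beta>) (at_left \<beta>)" "(cont_rep {\<alpha><..<\<beta>} u \<longlongrightarrow> v \<alpha>) (at_right \<alpha>)"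
    using Lim_transform_eventually by blast+
  then show "trace_left {\<alpha><..<\<beta>} u \<beta> = v \<beta>" "trace_right {\<alpha><..<\<beta>} u \<alpha> = v \<alpha>"
    unfolding trace_left_def trace_right_def by (auto intro: tendsto_Lim)
qed

subsection \<open>The Dirac structure\<close>

lemma AE_lebesgue_on_subset:
  assumes "AE z in lebesgue_on S. P z" "T \<subseteq> S" "S \<in> sets lebesgue" "T \<in> sets lebesgue"
  shows "AE z in lebesgue_on T. P z"
  using assms by (auto simp: AE_restrict_space_iff elim: eventually_mono)

lemma AE_lebesgue_on_split:
  fixes a b c :: real
  assumes "AE z in lebesgue_on {a<..<c}. P z" "AE z in lebesgue_on {c<..<b}. P z"
  shows "AE z in lebesgue_on {a..b}. P z"
proof -
  have "AE z in lebesgue. z \<noteq> c"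
    by (intro AE_completion AE_lborel_singleton)
  then show ?thesis
    using assms unfolding AE_lebesgue_on_Icc_iff_Ioo
    by (auto simp: AE_restrict_space_iff elim!: eventually_elim2)
qed

lemma L2_combine:
  fixes f :: "real \<Rightarrow> real"
  assumes "f \<in> L2 {a..c}" "f \<in> L2 {c..b}" "a \<le> c" "c \<le> b"
  shows "f \<in> L2 {a..b}"
proof -
  have 1: "(\<lambda>z. indicator {a..c} z *\<^sub>R f z) \<in> borel_measurable lebesgue"
      "(\<lambda>z. indicator {c..b} z *\<^sub>R f z) \<in> borel_measurable lebesgue"
    using assms(1,2)[THEN L2_D(1)] by (simp_all add: borel_measurable_restrict_space_iff)
  then have "(\<lambda>z. if z \<le> c then indicator {a..c} z *\<^sub>R f z else indicator {c..b} z *\<^sub>R f z) \<in> borel_measurable lebesgue"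
    by (intro measurable_If) auto
  also have "(\<lambda>z. if z \<le> c then indicator {a..c} z *\<^sub>R f z else indicator {c..b} z *\<^sub>R f z) =
      (\<lambda>z. indicator {a..b} z *\<^sub>R f z)"
    using assms(3,4) by (auto simp: indicator_def)
  finally have "f \<in> borel_measurable (lebesgue_on {a..b})"
    by (simp add: borel_measurable_restrict_space_iff)
  moreover have "integrable (lebesgue_on {a..b}) (\<lambda>z. (norm (f z))\<^sup>2)"
    by (rule integrable_combine[OF assms(1,2)[THEN L2_D(2)] assms(3,4)])
  ultimately show ?thesis by (simp add: L2_def)
qed

lemma LINT_support:
  fixes h :: "real \<Rightarrow> real"
  assumes "T \<subseteq> S" "S \<in> sets lebesgue" "T \<in> sets lebesgue" "\<And>z. z \<notin> T \<Longrightarrow> h z = 0"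
  shows "(LINT z|lebesgue_on S. h z) = (LINT z|lebesgue_on T. h z)"
proof -
  have "indicator S z *\<^sub>R h z = indicator T z *\<^sub>R h z" for z
    using assms(1,4) by (auto simp: indicator_def)
  then have "(LINT z|lebesgue. indicator S z *\<^sub>R h z) = (LINT z|lebesgue. indicator T z *\<^sub>R h z)"
    by (simp only:)
  then show ?thesis using assms(2,3) by (simp add: integral_restrict_space)
qed

lemma test_function_vanishes:
  assumes "\<phi> \<in> test_functions S" "z \<notin> S"
  shows "\<phi> z = 0" "deriv \<phi> z = 0"
proof -
  obtain K where K: "compact K" "K \<subseteq> S" "\<And>z. z \<notin> K \<Longrightarrow> \<phi> z = 0"
    using assms(1) by (auto simp: test_functions_def)
  have z: "z \<in> - K" using K(2) assms(2) by blast
  then show "\<phi> z = 0" using K(3) by simp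
  have "(\<phi> has_real_derivative 0) (at z)"
    by (rule has_field_derivative_transform_within_open[where S="- K" and f="\<lambda>_. 0"])
       (use K z in \<open>auto simp: compact_imp_closed open_Compl\<close>)
  then show "deriv \<phi> z = 0" by (rule DERIV_imp_deriv)
qed

lemma ac_rep_cong_AE:
  assumes "ac_rep \<alpha> \<beta> u v g" "AE z in lebesgue_on {\<alpha><..<\<beta>}. g z = h z"
  shows "ac_rep \<alpha> \<beta> u v h"
  using assms ac_on_cong_AE by (auto simp: ac_rep_def AE_lebesgue_on_Icc_iff_Ioo)

lemma ac_rep_add:
  assumes "ac_rep \<alpha> \<beta> u v g" "ac_rep \<alpha> \<beta> u' v' g'"
  shows "ac_rep \<alpha> \<beta> (\<lambda>z. u z + u' z) (\<lambda>z. v z + v' z) (\<lambda>z. g z + g' z)"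
  using assms ac_on_add by (auto simp: ac_rep_def elim: eventually_elim2)

lemma ac_rep_mult_left:
  assumes "ac_rep \<alpha> \<beta> u v g"
  shows "ac_rep \<alpha> \<beta> (\<lambda>z. c * u z) (\<lambda>z. c * v z) (\<lambda>z. c * g z)"
  using assms ac_on_mult_left by (auto simp: ac_rep_def elim: eventually_mono)

text \<open>Agreement is asked for inside the interval only, so a function defined by cases at
  \<open>0\<close> qualifies on either side with the formula of that side.\<close>

lemma ac_rep_DERIV:
  assumes "\<And>z. (v has_real_derivative g z) (at z)" "continuous_on UNIV g"
    and "\<And>z. z \<in> {\<alpha><..<\<beta>} \<Longrightarrow> u z = v z" "\<And>z. z \<in> {\<alpha><..<\<beta>} \<Longrightarrow> h z = g z"
  shows "ac_rep \<alpha> \<beta> u v h"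
proof (rule ac_rep_cong_AE)
  show "ac_rep \<alpha> \<beta> u v g"
    unfolding ac_rep_def using assms(1,3) continuous_on_subset[OF assms(2)]
    by (auto intro!: ac_on_DERIV AE_I2)
  show "AE z in lebesgue_on {\<alpha><..<\<beta>}. g z = h z"
    using assms(4) by (auto intro!: AE_I2)
qed

section \<open>Coordinates, ports and test efforts\<close>

lemma vector_4:
  fixes p q r s :: "'a::zero"
  shows "(vector [p, q, r, s] :: 'a^4) $ 1 = p" "(vector [p, q, r, s] :: 'a^4) $ 2 = q"
    "(vector [p, q, r, s] :: 'a^4) $ 3 = r" "(vector [p, q, r, s] :: 'a^4) $ 4 = s"
  unfolding vector_def by simp_all

lemma vector_4_eq_iff:
  "(x :: real^4) = vector [p, q, r, s] \<longleftrightarrow> x $ 1 = p \<and> x $ 2 = q \<and> x $ 3 = r \<and> x $ 4 = s"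
  by (simp add: vec_eq_iff forall_4 vector_4)

text \<open>In the structure \<open>p1\<close>, \<open>p2\<close> are the effort values at
  \<open>b\<close> and \<open>q1\<close>, \<open>q2\<close> those at \<open>a\<close>.
  \<open>R_ext\<close> is built so that the inner product of \<open>ed\<close> and \<open>fd\<close>
  collapses to \<open>q1 * q2 - p1 * p2\<close>, which is the boundary term of an integration by
  parts over \<open>[a, b]\<close>.\<close>

lemma R_ext_eq_iff:
  "stack fd ed = R_ext *v stack (vector [p1, p2]) (vector [q1, q2]) \<longleftrightarrow>
     sqrt 2 * fd $ 1 = q2 - p2 \<and> sqrt 2 * fd $ 2 = q1 - p1 \<and>
     sqrt 2 * ed $ 1 = p1 + q1 \<and> sqrt 2 * ed $ 2 = p2 + q2"
proof -
  have sum: "sum h (UNIV :: (2 + 2) set) = h (Inl 1) + h (Inl 2) + h (Inr 1) + h (Inr 2)" for h :: "2 + 2 \<Rightarrow> real"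
    unfolding UNIV_Plus_UNIV[symmetric] by (simp add: sum.Plus sum_2 del: UNIV_Plus_UNIV)
  have all: "(\<forall>i :: 2 + 2. P i) \<longleftrightarrow> P (Inl 1) \<and> P (Inl 2) \<and> P (Inr 1) \<and> P (Inr 2)" for P
    by (simp add: split_sum_all forall_2)
  have div: "x = y / sqrt 2 \<longleftrightarrow> sqrt 2 * x = y" for x y :: real
    by (auto simp: field_simps)
  show ?thesis
    unfolding vec_eq_iff all matrix_vector_mult_def
    by (simp add: sum R_ext_def block_matrix_def stack_def P1_def mat_def div algebra_simps)
       (auto simp: field_simps)
qed

text \<open>Phrased in the scaled ports, so that the equations of \<open>port_rep\<close> can be
  substituted directly.\<close>

lemma inner_port: "ed \<bullet> fd = (sqrt 2 * ed $ 1) * (sqrt 2 * fd $ 1) / 2 + (sqrt 2 * ed $ 2) * (sqrt 2 * fd $ 2) / 2"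
  for ed fd :: "real^2"
proof -
  have "(sqrt 2 * x) * (sqrt 2 * y) / 2 = x * y" for x y :: real
  proof -
    have "(sqrt 2 * x) * (sqrt 2 * y) / 2 = (sqrt 2 * sqrt 2) * (x * y) / 2" by (simp only: mult_ac)
    then show ?thesis by simp
  qed
  then show ?thesis by (simp only: inner_vec_def sum_2 inner_real_def)
qed

lemma coord_add: "coord i (f + g) = (\<lambda>z. coord i f z + coord i g z)"
  by (simp add: coord_def fun_eq_iff)

lemma coord_scaleR: "coord i (c *\<^sub>R f) = (\<lambda>z. c * coord i f z)"
  by (simp add: coord_def fun_eq_iff scaleR_fun_def)

lemma coord_zero: "coord i 0 = (\<lambda>z. 0)"
  by (simp add: coord_def)

lemma inner_coord: "e z \<bullet> f z = coord 1 e z * coord 1 f z + coord 2 e z * coord 2 f z +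
    coord 3 e z * coord 3 f z + coord 4 e z * coord 4 f z"
  by (simp add: inner_vec_def sum_4 coord_def)

text \<open>Each flow is minus the derivative of the other effort, so the integrand is minus the
  derivative of \<open>v1 * v2' + v1' * v2\<close>, and two integrations by parts give its boundary
  values. It is applied on an interval to one side of \<open>0\<close>, where the first efforts do
  not jump.\<close>

lemma half_pairing:
  assumes "\<alpha> \<le> \<beta>"
    and e1: "ac_rep \<alpha> \<beta> e1 v1 (\<lambda>z. - f2 z)" and e2: "ac_rep \<alpha> \<beta> e2 v2 (\<lambda>z. - f1 z)"
    and e1': "ac_rep \<alpha> \<beta> e1' v1' (\<lambda>z. - f2' z)" and e2': "ac_rep \<alpha> \<beta> e2' v2' (\<lambda>z. - f1' z)"
    and m: "e1 \<in> L2 {\<alpha>..\<beta>}" "e2 \<in> L2 {\<alpha>..\<beta>}" "e1' \<in> L2 {\<alpha>..\<beta>}" "e2' \<in> L2 {\<alpha>..\<beta>}"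
      "f1 \<in> L2 {\<alpha>..\<beta>}" "f2 \<in> L2 {\<alpha>..\<beta>}" "f1' \<in> L2 {\<alpha>..\<beta>}" "f2' \<in> L2 {\<alpha>..\<beta>}"
  shows "(LINT z|lebesgue_on {\<alpha>..\<beta>}. e1 z * f1' z + e2 z * f2' z + (e1' z * f1 z + e2' z * f2 z)) =
     - (v1 \<beta> * v2' \<beta> - v1 \<alpha> * v2' \<alpha> + (v1' \<beta> * v2 \<beta> - v1' \<alpha> * v2 \<alpha>))"
proof -
  let ?M = "lebesgue_on {\<alpha>..\<beta>}"
  have prod: "(LINT z|?M. v z * - f z) = - (LINT z|?M. u z * f z)"
    if u: "ac_rep \<alpha> \<beta> u v g" "u \<in> L2 {\<alpha>..\<beta>}" and f: "f \<in> L2 {\<alpha>..\<beta>}" for u v g f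
  proof -
    have "continuous_on {\<alpha>..\<beta>} v" using u(1) ac_on_continuous by (auto simp: ac_rep_def)
    then have "v \<in> borel_measurable ?M" by (rule continuous_imp_measurable_on_sets_lebesgue) simp
    moreover have "AE z in ?M. v z = u z"
      using u(1) by (simp add: ac_rep_def AE_lebesgue_on_Icc_iff_Ioo)
    then have "AE z in ?M. v z * - f z = - (u z * f z)" by eventually_elim simp
    ultimately have "(LINT z|?M. v z * - f z) = (LINT z|?M. - (u z * f z))"
      using L2_D(1)[OF u(2)] L2_D(1)[OF f] by (intro integral_cong_AE) auto
    then show ?thesis by simp
  qed
  have ac: "ac_on \<alpha> \<beta> v1 (\<lambda>z. - f2 z)" "ac_on \<alpha> \<beta> v2 (\<lambda>z. - f1 z)"
     "ac_on \<alpha> \<beta> v1' (\<lambda>z. - f2' z)" "ac_on \<alpha> \<beta> v2' (\<lambda>z. - f1' z)"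
    using e1 e2 e1' e2' by (simp_all add: ac_rep_def)
  have "(LINT z|?M. e1 z * f1' z + e2 z * f2' z + (e1' z * f1 z + e2' z * f2 z)) =
      (LINT z|?M. e1 z * f1' z) + (LINT z|?M. e2 z * f2' z) + ((LINT z|?M. e1' z * f1 z) + (LINT z|?M. e2' z * f2 z))"
    using m by (simp add: integrable_L2_mult)
  then show ?thesis
    using ac_on_integration_by_parts(3)[OF ac(1,4) assms(1)] ac_on_integration_by_parts(3)[OF ac(3,2) assms(1)]
    unfolding prod[OF e1 m(1,7)] prod[OF e2 m(2,8)] prod[OF e1' m(3,5)] prod[OF e2' m(4,6)]
    by linarith
qed

text \<open>Separate pieces on the two sides of \<open>0\<close> let the first coordinate jump
  there.\<close>

definition test_effort :: "(real \<Rightarrow> real) \<Rightarrow> (real \<Rightarrow> real) \<Rightarrow> (real \<Rightarrow> real) \<Rightarrow> real \<Rightarrow> real^4" where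
  "test_effort yl yr y2 z = vector [if z < 0 then yl z else yr z, y2 z, 0, 0]"

text \<open>The image of the effort under \<open>J0\<close> when \<open>gl\<close>,
  \<open>gr\<close>, \<open>g2\<close> are the derivatives of \<open>yl\<close>, \<open>yr\<close>,
  \<open>y2\<close>. The first minus sign is that inside \<open>d0\<close>, the second stands before
  \<open>d0_adj\<close> in \<open>J0\<close>.\<close>

definition test_flow :: "(real \<Rightarrow> real) \<Rightarrow> (real \<Rightarrow> real) \<Rightarrow> (real \<Rightarrow> real) \<Rightarrow> real \<Rightarrow> real^4" where
  "test_flow gl gr g2 z = vector [- g2 z, - (if z < 0 then gl z else gr z), 0, 0]"

lemma coord_test:
  "coord 1 (test_effort yl yr y2) = (\<lambda>z. if z < 0 then yl z else yr z)"
  "coord 2 (test_effort yl yr y2) = y2"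
  "coord 3 (test_effort yl yr y2) = (\<lambda>z. 0)" "coord 4 (test_effort yl yr y2) = (\<lambda>z. 0)"
  "coord 1 (test_flow gl gr g2) = (\<lambda>z. - g2 z)"
  "coord 2 (test_flow gl gr g2) = (\<lambda>z. - (if z < 0 then gl z else gr z))"
  "coord 3 (test_flow gl gr g2) = (\<lambda>z. 0)" "coord 4 (test_flow gl gr g2) = (\<lambda>z. 0)"
  by (simp_all add: coord_def test_effort_def test_flow_def vector_4 fun_eq_iff)

context
  fixes a b :: real
begin

text \<open>The relation between \<open>f\<close> and \<open>J0 a b e\<close> with the choices
  removed. \<open>vl\<close> and \<open>vr\<close> may disagree at \<open>0\<close>, while
  \<open>v2\<close> is one function on all of \<open>[a, b]\<close>.\<close>

definition bulk_rep :: "(real \<Rightarrow> real^4) \<Rightarrow> (real \<Rightarrow> real^4) \<Rightarrow> (real \<Rightarrow> real) \<Rightarrow> (real \<Rightarrow> real) \<Rightarrow> (real \<Rightarrow> real) \<Rightarrow> bool" where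
  "bulk_rep f e vl vr v2 \<longleftrightarrow>
     ac_rep a 0 (coord 1 e) vl (\<lambda>z. - coord 2 f z) \<and>
     ac_rep 0 b (coord 1 e) vr (\<lambda>z. - coord 2 f z) \<and>
     ac_rep a b (coord 2 e) v2 (\<lambda>z. - coord 1 f z) \<and>
     (AE z in lebesgue_on {a..b}. coord 3 f z = 0 \<and> coord 4 f z = 0)"

text \<open>The port conditions as equations between values of the representatives, with
  \<open>R_ext\<close> multiplied out. Unlike traces of chosen functions, these are visibly linear
  in all data jointly.\<close>

definition port_rep :: "port \<Rightarrow> port \<Rightarrow> (real \<Rightarrow> real) \<Rightarrow> (real \<Rightarrow> real) \<Rightarrow> (real \<Rightarrow> real) \<Rightarrow> bool" where
  "port_rep = (\<lambda>(f, fI, fd) (e, eI, ed) vl vr v2.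
     f \<in> L2 {a..b} \<and> e \<in> L2 {a..b} \<and> bulk_rep f e vl vr v2 \<and>
     fI = v2 0 \<and> eI = vl 0 - vr 0 \<and>
     sqrt 2 * fd $ 1 = v2 a - v2 b \<and> sqrt 2 * fd $ 2 = vl a - vr b \<and>
     sqrt 2 * ed $ 1 = vr b + vl a \<and> sqrt 2 * ed $ 2 = v2 b + v2 a)"

lemma port_rep_add:
  assumes "port_rep F E vl vr v2" "port_rep F' E' vl' vr' v2'"
  shows "port_rep (F + F') (E + E') (\<lambda>z. vl z + vl' z) (\<lambda>z. vr z + vr' z) (\<lambda>z. v2 z + v2' z)"
proof -
  obtain f fI fd where F: "F = (f, fI, fd)" by (cases F)
  obtain e eI ed where E: "E = (e, eI, ed)" by (cases E)
  obtain f' fI' fd' where F': "F' = (f', fI', fd')" by (cases F')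
  obtain e' eI' ed' where E': "E' = (e', eI', ed')" by (cases E')
  have "f + f' \<in> L2 {a..b}" "e + e' \<in> L2 {a..b}"
    using assms L2_add[of f "{a..b}" f'] L2_add[of e "{a..b}" e']
    by (simp_all add: port_rep_def F E F' E' plus_fun_def)
  moreover have "bulk_rep (f + f') (e + e') (\<lambda>z. vl z + vl' z) (\<lambda>z. vr z + vr' z) (\<lambda>z. v2 z + v2' z)"
    using assms ac_rep_add[of a 0 "coord 1 e" vl "\<lambda>z. - coord 2 f z" "coord 1 e'" vl' "\<lambda>z. - coord 2 f' z"]
      ac_rep_add[of 0 b "coord 1 e" vr "\<lambda>z. - coord 2 f z" "coord 1 e'" vr' "\<lambda>z. - coord 2 f' z"]
      ac_rep_add[of a b "coord 2 e" v2 "\<lambda>z. - coord 1 f z" "coord 2 e'" v2' "\<lambda>z. - coord 1 f' z"]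
    by (auto simp: port_rep_def F E F' E' bulk_rep_def coord_add elim: eventually_elim2)
  ultimately show ?thesis
    using assms by (simp add: port_rep_def F E F' E' algebra_simps)
qed

lemma port_rep_scaleR:
  assumes "port_rep F E vl vr v2"
  shows "port_rep (c *\<^sub>R F) (c *\<^sub>R E) (\<lambda>z. c * vl z) (\<lambda>z. c * vr z) (\<lambda>z. c * v2 z)"
proof -
  obtain f fI fd where F: "F = (f, fI, fd)" by (cases F)
  obtain e eI ed where E: "E = (e, eI, ed)" by (cases E)
  have "c *\<^sub>R f \<in> L2 {a..b}" "c *\<^sub>R e \<in> L2 {a..b}"
    using assms L2_scaleR[of f "{a..b}" c] L2_scaleR[of e "{a..b}" c]
    by (simp_all add: port_rep_def F E scaleR_fun_def)
  moreover have "bulk_rep (c *\<^sub>R f) (c *\<^sub>R e) (\<lambda>z. c * vl z) (\<lambda>z. c * vr z) (\<lambda>z. c * v2 z)"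
    using assms ac_rep_mult_left[of a 0 "coord 1 e" vl "\<lambda>z. - coord 2 f z" c]
      ac_rep_mult_left[of 0 b "coord 1 e" vr "\<lambda>z. - coord 2 f z" c]
      ac_rep_mult_left[of a b "coord 2 e" v2 "\<lambda>z. - coord 1 f z" c]
    by (auto simp: port_rep_def F E bulk_rep_def coord_scaleR elim: eventually_mono)
  moreover have "sqrt 2 * (c * x) = c * (sqrt 2 * x)" for x by simp
  ultimately show ?thesis
    using assms
    by (simp add: port_rep_def F E flip: right_diff_distrib distrib_left)
qed

lemma port_rep_zero: "port_rep 0 0 (\<lambda>z. 0) (\<lambda>z. 0) (\<lambda>z. 0)"
  by (simp add: port_rep_def zero_prod_def bulk_rep_def ac_rep_def ac_on_zero coord_def L2_zero zero_fun_def)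

context
  assumes a0: "a < 0" and b0: "0 < b"
begin

section \<open>Removing the choices from the operators and from the structure\<close>

lemma d0_adj_eq:
  assumes y: "y \<in> L2 {a..b}" and g: "g \<in> L2 {a..b}"
    and l: "ac_rep a 0 y vl g" and r: "ac_rep 0 b y vr g"
  shows "AE z in lebesgue_on {a..b}. d0_adj a b y z = g z"
proof -
  let ?P = "\<lambda>g. g \<in> L2 {a..b} \<and> is_weak_deriv {a<..<0} y g \<and> is_weak_deriv {0<..<b} y g"
  have sub: "h \<in> L2 {a<..<0}" "h \<in> L2 {0<..<b}" if "h \<in> L2 {a..b}" for h :: "real \<Rightarrow> real"
    by (rule L2_subset[OF that]; use a0 b0 in force)+
  have g': "?P g"
    using g ac_rep_imp_weak_deriv[OF l a0] ac_rep_imp_weak_deriv[OF r b0] sub[OF y] by (simp add: L2_D(1))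
  \<comment> \<open>\<open>g\<close> shows that the property behind \<open>SOME\<close> can be met;
    uniqueness of weak derivatives then fixes the chosen function on each half, and the point
    \<open>0\<close> is null.\<close>
  then have d: "?P (d0_adj a b y)"
    unfolding d0_adj_def by (rule someI[of ?P])
  show ?thesis
  proof (rule AE_lebesgue_on_split[where c=0])
    show "AE z in lebesgue_on {a<..<0}. d0_adj a b y z = g z"
      using d g' sub by (intro weak_deriv_unique integrable_L2) auto
    show "AE z in lebesgue_on {0<..<b}. d0_adj a b y z = g z"
      using d g' sub by (intro weak_deriv_unique integrable_L2) auto
  qed
qed

text \<open>\<open>c0\<close> and \<open>c0bar\<close> add up to 1 on the interval except at the
  null point \<open>0\<close>. For continuous \<open>x\<close> this is the cancellation of the Dirac
  masses of the two pieces.\<close>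

lemma dist_deriv_split:
  assumes x: "x \<in> L2 {a..b}" and \<phi>: "\<phi> \<in> test_functions {a<..<b}"
  shows "dist_deriv {a<..<b} (\<lambda>z. c0 a z * x z) \<phi> + dist_deriv {a<..<b} (\<lambda>z. c0bar b z * x z) \<phi> =
    dist_deriv {a<..<b} x \<phi>"
proof -
  let ?M = "lebesgue_on {a<..<b}"
  have i: "integrable ?M (\<lambda>z. x z * deriv \<phi> z)"
    by (intro integrable_mult_test_function test_function_deriv_continuous[OF \<phi>] integrable_L2)
       (use x in \<open>simp_all add: L2_Icc_iff_Ioo\<close>)
  have ind: "integrable ?M (\<lambda>z. indicator A z * x z * deriv \<phi> z)" if "A \<in> sets borel" for A :: "real set"
  proof (rule Bochner_Integration.integrable_bound[OF i])
    have "indicat_real A \<in> borel_measurable ?M"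
      using that by (intro measurable_restrict_space1 borel_measurable_indicator) simp
    then show "(\<lambda>z. indicator A z * x z * deriv \<phi> z) \<in> borel_measurable ?M"
      using borel_measurable_times[OF _ borel_measurable_integrable[OF i], of "indicat_real A"]
      by (simp add: mult.assoc)
  qed (auto simp: indicator_def)
  have "AE z in lebesgue. z \<noteq> 0"
    by (intro AE_completion AE_lborel_singleton)
  then have "AE z in ?M. x z * deriv \<phi> z = c0 a z * x z * deriv \<phi> z + c0bar b z * x z * deriv \<phi> z"
    by (auto simp: AE_restrict_space_iff c0_def c0bar_def indicator_def elim!: eventually_mono)
  then have "(LINT z|?M. x z * deriv \<phi> z) =
      (LINT z|?M. c0 a z * x z * deriv \<phi> z + c0bar b z * x z * deriv \<phi> z)"
    by (intro integral_cong_AE Bochner_Integration.borel_measurable_integrable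
        Bochner_Integration.integrable_add i) (auto simp: c0_def c0bar_def intro!: ind)
  also have "\<dots> = (LINT z|?M. c0 a z * x z * deriv \<phi> z) + (LINT z|?M. c0bar b z * x z * deriv \<phi> z)"
    by (intro Bochner_Integration.integral_add) (auto simp: c0_def c0bar_def intro!: ind)
  finally show ?thesis by (simp add: dist_deriv_def)
qed

lemma d0_eq:
  assumes x: "x \<in> L2 {a..b}" and g: "g \<in> L2 {a..b}" and rep: "ac_rep a b x v g"
  shows "AE z in lebesgue_on {a..b}. d0 a b x z = - g z"
proof -
  let ?M = "lebesgue_on {a<..<b}"
  have ab: "a < b" using a0 b0 by simp
  let ?P = "\<lambda>f. f \<in> L2 {a..b} \<and> (\<forall>\<phi>\<in>test_functions {a<..<b}. (LINT z|?M. f z * \<phi> z) =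
          - (dist_deriv {a<..<b} (\<lambda>z. c0 a z * x z) \<phi> + dist_deriv {a<..<b} (\<lambda>z. c0bar b z * x z) \<phi>))"
  have "is_weak_deriv {a<..<b} x g"
    by (rule ac_rep_imp_weak_deriv[OF rep ab]) (use x in \<open>simp add: L2_Icc_iff_Ioo L2_D(1)\<close>)
  then have w: "(LINT z|?M. g z * \<phi> z) = dist_deriv {a<..<b} x \<phi>" if "\<phi> \<in> test_functions {a<..<b}" for \<phi>
    using that by (simp add: is_weak_deriv_def)
  \<comment> \<open>The sign is the one in front of the bracket in \<open>d0\<close>.\<close>
  have "?P (\<lambda>z. - g z)"
    using L2_minus[OF g] by (simp add: dist_deriv_split[OF x] w)
  then have d: "?P (d0 a b x)"
    unfolding d0_def by (rule someI[of ?P])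
  have "AE z in ?M. d0 a b x z + g z = 0"
  proof (rule fundamental_lemma)
    have di: "integrable ?M (d0 a b x)" and gi: "integrable ?M g"
      using d g by (auto simp: L2_Icc_iff_Ioo intro!: integrable_L2)
    then show "integrable ?M (\<lambda>z. d0 a b x z + g z)" by simp
    fix \<phi> assume \<phi>: "\<phi> \<in> test_functions {a<..<b}"
    have "(LINT z|?M. d0 a b x z * \<phi> z) = - dist_deriv {a<..<b} x \<phi>"
      using d \<phi> by (simp only: dist_deriv_split[OF x \<phi>])
    then show "(LINT z|?M. (d0 a b x z + g z) * \<phi> z) = 0"
      using integrable_mult_test_function[OF di test_function_continuous[OF \<phi>]]
        integrable_mult_test_function[OF gi test_function_continuous[OF \<phi>]] w[OF \<phi>]
      by (simp add: distrib_right)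
  qed
  then show ?thesis
    unfolding AE_lebesgue_on_Icc_iff_Ioo by eventually_elim simp
qed

lemma J0_eq_iff_bulk_rep:
  assumes f: "f \<in> L2 {a..b}" and e: "e \<in> L2 {a..b}"
  shows "e \<in> dom_J0 a b \<and> (AE z in lebesgue_on {a..b}. f z = J0 a b e z) \<longleftrightarrow> (\<exists>vl vr v2. bulk_rep f e vl vr v2)"
proof
  have ab: "a < b" using a0 b0 by simp
  have fc: "coord i f \<in> L2 {a..b}" and ec: "coord i e \<in> L2 {a..b}" for i
    using f e by (auto simp: L2_coord)
  have sub: "AE z in lebesgue_on {a<..<0}. P z" "AE z in lebesgue_on {0<..<b}. P z"
    if "AE z in lebesgue_on {a..b}. P z" for P
    by (rule AE_lebesgue_on_subset[OF that]; use a0 b0 in force)+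
  {
    assume *: "e \<in> dom_J0 a b \<and> (AE z in lebesgue_on {a..b}. f z = J0 a b e z)"
    obtain vl gl where l: "ac_rep a 0 (coord 1 e) vl gl" "gl \<in> L2 {a..0}"
      using * H1_ac_rep[OF _ a0] by (auto simp: dom_J0_def dom_d0_adj_def)
    obtain vr gr where r: "ac_rep 0 b (coord 1 e) vr gr" "gr \<in> L2 {0..b}"
      using * H1_ac_rep[OF _ b0] by (auto simp: dom_J0_def dom_d0_adj_def)
    obtain v2 g2 where 2: "ac_rep a b (coord 2 e) v2 g2" "g2 \<in> L2 {a..b}"
      using * H1_ac_rep[OF _ ab] by (auto simp: dom_J0_def dom_d0_def)
    \<comment> \<open>The two halves come with independent derivatives \<open>gl\<close> and
      \<open>gr\<close>, while \<open>d0_adj_eq\<close> wants a single function serving both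
      sides.\<close>
    define g where "g = (\<lambda>z. if z < 0 then gl z else gr z)"
    have gl: "ac_rep a 0 (coord 1 e) vl g"
      by (rule ac_rep_cong_AE[OF l(1)]) (auto simp: g_def intro!: AE_I2)
    have gr: "ac_rep 0 b (coord 1 e) vr g"
      by (rule ac_rep_cong_AE[OF r(1)]) (auto simp: g_def intro!: AE_I2)
    have "g \<in> L2 {a..0}"
      unfolding L2_Icc_iff_Ioo
      by (rule L2_cong_AE[OF l(2)[unfolded L2_Icc_iff_Ioo]]) (auto simp: g_def intro!: AE_I2)
    moreover have "g \<in> L2 {0..b}"
      by (rule L2_cong_AE[OF r(2)]) (auto simp: g_def intro!: AE_I2)
    ultimately have g: "g \<in> L2 {a..b}" using a0 b0 by (simp add: L2_combine[of g a 0 b])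
    have "AE z in lebesgue_on {a..b}. f z = vector [- g2 z, - g z, 0, 0]"
      using conjunct2[OF *] d0_eq[OF ec 2(2,1)] d0_adj_eq[OF ec g gl gr]
      by eventually_elim (simp add: J0_def)
    then have ae: "AE z in lebesgue_on {a..b}. coord 1 f z = - g2 z \<and> coord 2 f z = - g z \<and> coord 3 f z = 0 \<and> coord 4 f z = 0"
      by eventually_elim (simp add: vector_4_eq_iff coord_def)
    have "ac_rep a 0 (coord 1 e) vl (\<lambda>z. - coord 2 f z)"
      by (rule ac_rep_cong_AE[OF gl]) (use sub(1)[OF ae] in \<open>auto elim: eventually_mono\<close>)
    moreover have "ac_rep 0 b (coord 1 e) vr (\<lambda>z. - coord 2 f z)"
      by (rule ac_rep_cong_AE[OF gr]) (use sub(2)[OF ae] in \<open>auto elim: eventually_mono\<close>)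
    moreover have "ac_rep a b (coord 2 e) v2 (\<lambda>z. - coord 1 f z)"
      by (rule ac_rep_cong_AE[OF 2(1)])
         (use ae in \<open>auto simp: AE_lebesgue_on_Icc_iff_Ioo elim: eventually_mono\<close>)
    ultimately show "\<exists>vl vr v2. bulk_rep f e vl vr v2"
      using ae unfolding bulk_rep_def by (auto elim: eventually_mono)
  }
  {
    assume "\<exists>vl vr v2. bulk_rep f e vl vr v2"
    then obtain vl vr v2 where l: "ac_rep a 0 (coord 1 e) vl (\<lambda>z. - coord 2 f z)"
        and r: "ac_rep 0 b (coord 1 e) vr (\<lambda>z. - coord 2 f z)"
        and 2: "ac_rep a b (coord 2 e) v2 (\<lambda>z. - coord 1 f z)"
        and z: "AE z in lebesgue_on {a..b}. coord 3 f z = 0 \<and> coord 4 f z = 0"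
      by (auto simp: bulk_rep_def)
    have m: "(\<lambda>z. - coord i f z) \<in> L2 {a..b}" for i
      by (rule L2_minus[OF fc])
    have "(\<lambda>z. - coord 2 f z) \<in> L2 {a..0}" "(\<lambda>z. - coord 2 f z) \<in> L2 {0..b}"
      by (rule L2_subset[OF m]; use a0 b0 in force)+
    then have "e \<in> dom_J0 a b"
      using ec ac_rep_H1[OF l a0] ac_rep_H1[OF r b0] ac_rep_H1[OF 2 ab m]
      by (simp add: dom_J0_def dom_d0_adj_def dom_d0_def)
    moreover have "AE z in lebesgue_on {a..b}. f z = J0 a b e z"
      using z d0_eq[OF ec m 2] d0_adj_eq[OF ec m l r]
      by eventually_elim (simp add: J0_def vector_4_eq_iff coord_def)
    ultimately show "e \<in> dom_J0 a b \<and> (AE z in lebesgue_on {a..b}. f z = J0 a b e z)" ..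
  }
qed

lemma D_J0_iff: "(F, E) \<in> D_J0 a b \<longleftrightarrow> (\<exists>vl vr v2. port_rep F E vl vr v2)"
proof -
  obtain f fI fd where F: "F = (f, fI, fd)" by (cases F)
  obtain e eI ed where E: "E = (e, eI, ed)" by (cases E)
  have ab: "a < b" "0 \<in> {a<..<b}" using a0 b0 by auto
  let ?B = "\<lambda>vl vr v2. fI = v2 0 \<and> eI = vl 0 - vr 0 \<and>
     sqrt 2 * fd $ 1 = v2 a - v2 b \<and> sqrt 2 * fd $ 2 = vl a - vr b \<and>
     sqrt 2 * ed $ 1 = vr b + vl a \<and> sqrt 2 * ed $ 2 = v2 b + v2 a"
  \<comment> \<open>Every choice of representatives yields the same port conditions, namely those on
    traces, so they can move across the existential quantifier.\<close>
  have B: "?B vl vr v2 \<longleftrightarrow> fI = cont_rep {a<..<b} (coord 2 e) 0 \<and>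
     eI = trace_left {a<..<0} (coord 1 e) 0 - trace_right {0<..<b} (coord 1 e) 0 \<and>
     stack fd ed = R_ext *v
       stack (vector [trace_left {0<..<b} (coord 1 e) b, trace_left {a<..<b} (coord 2 e) b])
             (vector [trace_right {a<..<0} (coord 1 e) a, trace_right {a<..<b} (coord 2 e) a])"
    if "bulk_rep f e vl vr v2" for vl vr v2
  proof -
    have "ac_rep a 0 (coord 1 e) vl (\<lambda>z. - coord 2 f z)" "ac_rep 0 b (coord 1 e) vr (\<lambda>z. - coord 2 f z)"
      "ac_rep a b (coord 2 e) v2 (\<lambda>z. - coord 1 f z)"
      using that by (simp_all add: bulk_rep_def)
    note reps = this
    show ?thesis
      unfolding R_ext_eq_iff trace_eq[OF reps(1) a0] trace_eq[OF reps(2) b0] trace_eq[OF reps(3) ab(1)]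
        cont_rep_eq[OF reps(3) ab(2)] by (rule refl)
  qed
  show ?thesis
  proof (cases "f \<in> L2 {a..b} \<and> e \<in> L2 {a..b}")
    case True
    then have "(F, E) \<in> D_J0 a b \<longleftrightarrow> (\<exists>vl vr v2. bulk_rep f e vl vr v2) \<and>
        fI = cont_rep {a<..<b} (coord 2 e) 0 \<and>
        eI = trace_left {a<..<0} (coord 1 e) 0 - trace_right {0<..<b} (coord 1 e) 0 \<and>
        stack fd ed = R_ext *v
          stack (vector [trace_left {0<..<b} (coord 1 e) b, trace_left {a<..<b} (coord 2 e) b])
             (vector [trace_right {a<..<0} (coord 1 e) a, trace_right {a<..<b} (coord 2 e) a])"
      by (simp add: D_J0_def F E bond_space_def port_space_def flip: J0_eq_iff_bulk_rep)
    also have "\<dots> \<longleftrightarrow> (\<exists>vl vr v2. bulk_rep f e vl vr v2 \<and> ?B vl vr v2)"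
      using B by blast
    finally show ?thesis using True by (simp add: port_rep_def F E)
  next
    case False
    then show ?thesis by (auto simp: D_J0_def port_rep_def F E bond_space_def port_space_def)
  qed
qed

section \<open>Linearity and isotropy\<close>

lemma bulk_pairing:
  assumes rep: "bulk_rep f e vl vr v2" and rep': "bulk_rep f' e' vl' vr' v2'"
    and L2: "f \<in> L2 {a..b}" "e \<in> L2 {a..b}" "f' \<in> L2 {a..b}" "e' \<in> L2 {a..b}"
  shows "(LINT z|lebesgue_on {a..b}. e z \<bullet> f' z) + (LINT z|lebesgue_on {a..b}. e' z \<bullet> f z) =
    - (vl 0 * v2' 0 - vl a * v2' a + (vl' 0 * v2 0 - vl' a * v2 a)) -
      (vr b * v2' b - vr 0 * v2' 0 + (vr' b * v2 b - vr' 0 * v2 0))"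
proof -
  let ?M = "lebesgue_on {a..b}"
  let ?h = "\<lambda>z. coord 1 e z * coord 1 f' z + coord 2 e z * coord 2 f' z +
      (coord 1 e' z * coord 1 f z + coord 2 e' z * coord 2 f z)"
  have c: "coord i f \<in> L2 {a..b}" "coord i e \<in> L2 {a..b}" "coord i f' \<in> L2 {a..b}" "coord i e' \<in> L2 {a..b}" for i
    using L2 by (simp_all add: L2_coord)
  have sub: "h \<in> L2 {a..0}" "h \<in> L2 {0..b}" if "h \<in> L2 {a..b}" for h :: "real \<Rightarrow> real"
    by (rule L2_subset[OF that]; use a0 b0 in force)+
  \<comment> \<open>A representative of the second effort on \<open>[a, b]\<close> serves on both
    halves; only the first effort has a different one on each.\<close>
  have ac_sub: "ac_rep a 0 u v g" "ac_rep 0 b u v g" if "ac_rep a b u v g" for u v g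
    using that a0 b0 ac_on_subinterval[of a b v g]
    by (auto simp: ac_rep_def elim!: AE_lebesgue_on_subset)
  have ih: "integrable ?M ?h"
    by (intro Bochner_Integration.integrable_add integrable_L2_mult c)
  have "AE z in ?M. coord 3 f z = 0 \<and> coord 4 f z = 0" "AE z in ?M. coord 3 f' z = 0 \<and> coord 4 f' z = 0"
    using rep rep' by (simp_all add: bulk_rep_def)
  \<comment> \<open>Efforts 3 and 4 are arbitrary, but they meet flows that vanish.\<close>
  then have "AE z in ?M. e z \<bullet> f' z + e' z \<bullet> f z = ?h z"
    by eventually_elim (simp add: inner_coord)
  then have "(LINT z|?M. e z \<bullet> f' z + e' z \<bullet> f z) = (LINT z|?M. ?h z)"
    by (intro integral_cong_AE borel_measurable_integrable[OF ih] borel_measurable_integrable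
        Bochner_Integration.integrable_add integrable_L2_inner L2)
  also have "\<dots> = (LINT z|lebesgue_on {a..0}. ?h z) + (LINT z|lebesgue_on {0..b}. ?h z)"
    using a0 b0 by (intro Equivalence_Measurable_On_Borel.integral_combine[OF ih]) auto
  also have "(LINT z|lebesgue_on {a..0}. ?h z) = - (vl 0 * v2' 0 - vl a * v2' a + (vl' 0 * v2 0 - vl' a * v2 a))"
    using rep rep' a0 by (intro half_pairing sub c) (auto simp: bulk_rep_def intro: ac_sub)
  also have "(LINT z|lebesgue_on {0..b}. ?h z) = - (vr b * v2' b - vr 0 * v2' 0 + (vr' b * v2 b - vr' 0 * v2 0))"
    using rep rep' b0 by (intro half_pairing sub c) (auto simp: bulk_rep_def intro: ac_sub)
  finally show ?thesis
    using integrable_L2_inner[OF L2(2,3)] integrable_L2_inner[OF L2(4,1)] by simp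
qed

lemma subspace_D_J0: "subspace (D_J0 a b)"
proof (rule subspaceI)
  show "0 \<in> D_J0 a b"
    unfolding zero_prod_def D_J0_iff using port_rep_zero by (auto simp: zero_prod_def)
  show "x + y \<in> D_J0 a b" if "x \<in> D_J0 a b" "y \<in> D_J0 a b" for x y
  proof -
    obtain F E where x: "x = (F, E)" by (cases x)
    obtain F' E' where y: "y = (F', E')" by (cases y)
    show ?thesis
      using that port_rep_add unfolding x y add_Pair D_J0_iff by blast
  qed
  show "c *\<^sub>R x \<in> D_J0 a b" if "x \<in> D_J0 a b" for c x
  proof -
    obtain F E where x: "x = (F, E)" by (cases x)
    show ?thesis
      using that port_rep_scaleR unfolding x scaleR_Pair D_J0_iff by blast
  qed
qed

text \<open>At \<open>0\<close> the integrals leave \<open>(vr 0 - vl 0) * v2' 0\<close> and its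
  counterpart with primes exchanged, which are minus \<open>eI * fI'\<close> and
  \<open>eI' * fI\<close>. At \<open>a\<close> and \<open>b\<close> they leave the polarised form of
  \<open>q1 * q2 - p1 * p2\<close>, which the port inner products remove.\<close>

lemma D_J0_isotropic:
  assumes "v \<in> D_J0 a b" "w \<in> D_J0 a b"
  shows "plus_pairing (power_pairing a b) v w = 0"
proof -
  obtain f fI fd e eI ed where v: "v = ((f, fI, fd), (e, eI, ed))" by (metis prod.exhaust)
  obtain f' fI' fd' e' eI' ed' where w: "w = ((f', fI', fd'), (e', eI', ed'))" by (metis prod.exhaust)
  obtain vl vr v2 where rv: "port_rep (f, fI, fd) (e, eI, ed) vl vr v2"
    using assms(1) by (auto simp: v D_J0_iff)
  obtain vl' vr' v2' where rw: "port_rep (f', fI', fd') (e', eI', ed') vl' vr' v2'"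
    using assms(2) by (auto simp: w D_J0_iff)
  have "(LINT z|lebesgue_on {a..b}. e z \<bullet> f' z) + (LINT z|lebesgue_on {a..b}. e' z \<bullet> f z) =
    - (vl 0 * v2' 0 - vl a * v2' a + (vl' 0 * v2 0 - vl' a * v2 a)) -
      (vr b * v2' b - vr 0 * v2' 0 + (vr' b * v2 b - vr' 0 * v2 0))"
    using rv rw by (intro bulk_pairing) (auto simp: port_rep_def)
  moreover have "plus_pairing (power_pairing a b) v w =
      (LINT z|lebesgue_on {a..b}. e z \<bullet> f' z) + (LINT z|lebesgue_on {a..b}. e' z \<bullet> f z) +
      eI * fI' + eI' * fI - ed \<bullet> fd' - ed' \<bullet> fd"
    by (simp add: v w plus_pairing_def power_pairing_def)
  moreover have "ed \<bullet> fd' = (vr b + vl a) * (v2' a - v2' b) / 2 + (v2 b + v2 a) * (vl' a - vr' b) / 2"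
    "ed' \<bullet> fd = (vr' b + vl' a) * (v2 a - v2 b) / 2 + (v2' b + v2' a) * (vl a - vr b) / 2"
    using rv rw unfolding inner_port port_rep_def by simp_all
  moreover have "eI = vl 0 - vr 0" "fI = v2 0" "eI' = vl' 0 - vr' 0" "fI' = v2' 0"
    using rv rw by (simp_all add: port_rep_def)
  ultimately show ?thesis by (simp add: field_simps)
qed

section \<open>Maximality: testing an element of the orthogonal companion\<close>

lemma L2_piecewise:
  fixes yl yr :: "real \<Rightarrow> real"
  assumes "continuous_on UNIV yl" "continuous_on UNIV yr"
  shows "(\<lambda>z. if z < 0 then yl z else yr z) \<in> L2 {a..b}"
proof (rule L2_combine[where c=0])
  have "yl \<in> L2 {a<..<0}"
    using L2_continuous[OF continuous_on_subset[OF assms(1) subset_UNIV]] by (simp add: L2_Icc_iff_Ioo[symmetric])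
  then have "(\<lambda>z. if z < 0 then yl z else yr z) \<in> L2 {a<..<0}"
    by (rule L2_cong_AE) (auto intro!: AE_I2)
  then show "(\<lambda>z. if z < 0 then yl z else yr z) \<in> L2 {a..0}"
    by (simp add: L2_Icc_iff_Ioo)
  have "yr \<in> L2 {0..b}"
    using L2_continuous[OF continuous_on_subset[OF assms(2) subset_UNIV]] .
  then show "(\<lambda>z. if z < 0 then yl z else yr z) \<in> L2 {0..b}"
    by (rule L2_cong_AE) (auto intro!: AE_I2)
qed (use a0 b0 in auto)

text \<open>Supplies the members of the structure used for testing: the pieces are chosen freely on
  the two sides of \<open>0\<close>, and the port values are then forced.\<close>

lemma test_port:
  assumes l: "\<And>z. (yl has_real_derivative gl z) (at z)" "continuous_on UNIV gl"
    and r: "\<And>z. (yr has_real_derivative gr z) (at z)" "continuous_on UNIV gr"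
    and 2: "\<And>z. (y2 has_real_derivative g2 z) (at z)" "continuous_on UNIV g2"
  shows "port_rep
     (test_flow gl gr g2, y2 0, vector [(y2 a - y2 b) / sqrt 2, (yl a - yr b) / sqrt 2])
     (test_effort yl yr y2, yl 0 - yr 0, vector [(yr b + yl a) / sqrt 2, (y2 b + y2 a) / sqrt 2]) yl yr y2"
proof -
  have c: "continuous_on UNIV yl" "continuous_on UNIV yr" "continuous_on UNIV y2"
    using l(1) r(1) 2(1) by (auto intro!: continuous_at_imp_continuous_on DERIV_isCont)
  have cL2: "h \<in> L2 {a..b}" if "continuous_on UNIV h" for h :: "real \<Rightarrow> real"
    using L2_continuous[OF continuous_on_subset[OF that subset_UNIV]] .
  have "test_flow gl gr g2 \<in> L2 {a..b}" "test_effort yl yr y2 \<in> L2 {a..b}"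
    unfolding L2_coord forall_4 coord_test
    using L2_minus[OF cL2[OF 2(2)]] L2_minus[OF L2_piecewise[OF l(2) r(2)]]
      cL2[OF c(3)] L2_piecewise[OF c(1,2)] L2_zero by simp_all
  moreover have "bulk_rep (test_flow gl gr g2) (test_effort yl yr y2) yl yr y2"
    unfolding bulk_rep_def coord_test
    using ac_rep_DERIV[OF l] ac_rep_DERIV[OF r] ac_rep_DERIV[OF 2] by simp
  ultimately show ?thesis
    by (simp add: port_rep_def)
qed

text \<open>Available before any regularity of \<open>e\<close> is known, so it serves both rounds
  of testing: with test functions to obtain weak derivatives, and with polynomials
  afterwards.\<close>

lemma orth_test:
  assumes w: "((f, fI, fd), (e, eI, ed)) \<in> orth_companion (bond_space a b) (power_pairing a b) (D_J0 a b)"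
    and l: "\<And>z. (yl has_real_derivative gl z) (at z)" "continuous_on UNIV gl"
    and r: "\<And>z. (yr has_real_derivative gr z) (at z)" "continuous_on UNIV gr"
    and 2: "\<And>z. (y2 has_real_derivative g2 z) (at z)" "continuous_on UNIV g2"
  shows "(LINT z|lebesgue_on {a..b}. test_effort yl yr y2 z \<bullet> f z) +
     (LINT z|lebesgue_on {a..b}. e z \<bullet> test_flow gl gr g2 z) +
     (yl 0 - yr 0) * fI + eI * y2 0 =
     ((yr b + yl a) * fd $ 1 + (y2 b + y2 a) * fd $ 2 +
       ed $ 1 * (y2 a - y2 b) + ed $ 2 * (yl a - yr b)) / sqrt 2"
proof -
  have "((test_flow gl gr g2, y2 0, vector [(y2 a - y2 b) / sqrt 2, (yl a - yr b) / sqrt 2]),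
     (test_effort yl yr y2, yl 0 - yr 0, vector [(yr b + yl a) / sqrt 2, (y2 b + y2 a) / sqrt 2])) \<in> D_J0 a b"
    unfolding D_J0_iff using test_port[OF l r 2] by blast
  with w have "plus_pairing (power_pairing a b)
     ((test_flow gl gr g2, y2 0, vector [(y2 a - y2 b) / sqrt 2, (yl a - yr b) / sqrt 2]),
     (test_effort yl yr y2, yl 0 - yr 0, vector [(yr b + yl a) / sqrt 2, (y2 b + y2 a) / sqrt 2]))
     ((f, fI, fd), (e, eI, ed)) = 0"
    by (auto simp: orth_companion_def)
  then show ?thesis
    by (simp add: plus_pairing_def power_pairing_def inner_vec_def[where 'b=2] sum_2 add_divide_distrib
        diff_divide_distrib algebra_simps)
qed

lemma orth_bulk_rep:
  assumes w: "((f, fI, fd), (e, eI, ed)) \<in> orth_companion (bond_space a b) (power_pairing a b) (D_J0 a b)"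
  obtains wl wr w2 where "bulk_rep f e wl wr w2" "f \<in> L2 {a..b}" "e \<in> L2 {a..b}"
proof -
  have ab: "a < b" using a0 b0 by simp
  have f: "f \<in> L2 {a..b}" and e: "e \<in> L2 {a..b}"
    using w by (auto simp: orth_companion_def bond_space_def port_space_def)
  have fc: "coord i f \<in> L2 {a..b}" and ec: "coord i e \<in> L2 {a..b}" for i
    using f e by (auto simp: L2_coord)
  have sub: "h \<in> L2 {c<..<d}" if "h \<in> L2 {a..b}" "a \<le> c" "d \<le> b" for c d and h :: "real \<Rightarrow> real"
    by (rule L2_subset[OF that(1)]) (use that in auto)
  have D: "(\<phi> has_real_derivative deriv \<phi> z) (at z)" "continuous_on UNIV (deriv \<phi>)"
    if "\<phi> \<in> test_functions S" for \<phi> z S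
    using test_function_DERIV[OF that, of 0] test_function_deriv_continuous[OF that] by simp_all
  have Z: "((\<lambda>z. 0) has_real_derivative 0) (at z)" "continuous_on UNIV (\<lambda>z. 0 :: real)" for z :: real
    by simp_all
  have weak: "is_weak_deriv {c<..<d} (coord j e) (\<lambda>z. - coord i f z)"
    if cd: "a \<le> c" "c < d" "d \<le> b" and
      *: "\<And>\<phi>. \<phi> \<in> test_functions {c<..<d} \<Longrightarrow>
         (LINT z|lebesgue_on {a..b}. \<phi> z * coord i f z) + (LINT z|lebesgue_on {a..b}. - (coord j e z * deriv \<phi> z)) = 0"
    for c d i j
    unfolding is_weak_deriv_def dist_deriv_def
  proof
    fix \<phi> assume \<phi>: "\<phi> \<in> test_functions {c<..<d}"
    have "(LINT z|lebesgue_on {a..b}. \<phi> z * coord i f z) = (LINT z|lebesgue_on {c<..<d}. \<phi> z * coord i f z)"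
      by (rule LINT_support) (use cd test_function_vanishes[OF \<phi>] in auto)
    moreover have "(LINT z|lebesgue_on {a..b}. - (coord j e z * deriv \<phi> z)) =
        (LINT z|lebesgue_on {c<..<d}. - (coord j e z * deriv \<phi> z))"
      by (rule LINT_support) (use cd test_function_vanishes[OF \<phi>] in auto)
    ultimately show "(LINT z|lebesgue_on {c<..<d}. - coord i f z * \<phi> z) = - (LINT z|lebesgue_on {c<..<d}. coord j e z * deriv \<phi> z)"
      using *[OF \<phi>] by (simp add: mult.commute)
  qed
  have rep: "\<exists>v. ac_rep c d (coord j e) v (\<lambda>z. - coord i f z)"
    if cd: "a \<le> c" "c < d" "d \<le> b" and wd: "is_weak_deriv {c<..<d} (coord j e) (\<lambda>z. - coord i f z)" for c d i j
  proof -
    have "integrable (lebesgue_on {c<..<d}) (coord j e)" "integrable (lebesgue_on {c<..<d}) (\<lambda>z. - coord i f z)"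
      using integrable_L2[OF sub[OF ec cd(1,3)]] integrable_L2[OF L2_minus[OF sub[OF fc cd(1,3)]]] by simp_all
    then show ?thesis using weak_deriv_imp_ac_rep[OF wd cd(2)] by blast
  qed
  \<comment> \<open>The first effort is \<open>\<phi>\<close> on both sides of \<open>0\<close>. It
    may be nonzero there, but the factor of \<open>fI\<close> is the jump
    \<open>\<phi> 0 - \<phi> 0\<close>; at \<open>a\<close> and \<open>b\<close> everything
    vanishes.\<close>
  have T1: "(LINT z|lebesgue_on {a..b}. \<phi> z * coord 1 f z) + (LINT z|lebesgue_on {a..b}. - (coord 2 e z * deriv \<phi> z)) = 0"
    if \<phi>: "\<phi> \<in> test_functions {a<..<b}" for \<phi>
    using orth_test[OF w D[OF \<phi>] D[OF \<phi>] Z] test_function_vanishes(1)[OF \<phi>]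
    by (simp add: inner_coord coord_test)
  \<comment> \<open>Now \<open>y2 = \<phi>\<close>, and the term \<open>eI * y2 0\<close> contains
    the still unknown \<open>eI\<close>. Keeping \<open>0\<close> out of \<open>S\<close> removes
    it, which is why the first effort is tested on the two halves separately.\<close>
  have T2: "(LINT z|lebesgue_on {a..b}. \<phi> z * coord 2 f z) + (LINT z|lebesgue_on {a..b}. - (coord 1 e z * deriv \<phi> z)) = 0"
    if \<phi>: "\<phi> \<in> test_functions S" "a \<notin> S" "0 \<notin> S" "b \<notin> S" for \<phi> S
    using orth_test[OF w Z Z D[OF \<phi>(1)]] test_function_vanishes(1)[OF \<phi>(1)] \<phi>
    by (simp add: inner_coord coord_test)
  have "is_weak_deriv {a<..<0} (coord 1 e) (\<lambda>z. - coord 2 f z)"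
    by (rule weak[OF _ a0 _ T2]) (use b0 in auto)
  then obtain wl where wl: "ac_rep a 0 (coord 1 e) wl (\<lambda>z. - coord 2 f z)"
    using rep[OF order_refl a0] b0 by auto
  have "is_weak_deriv {0<..<b} (coord 1 e) (\<lambda>z. - coord 2 f z)"
    by (rule weak[OF _ b0 _ T2]) (use a0 in auto)
  then obtain wr where wr: "ac_rep 0 b (coord 1 e) wr (\<lambda>z. - coord 2 f z)"
    using rep[OF _ b0 order_refl] a0 by auto
  have "is_weak_deriv {a<..<b} (coord 2 e) (\<lambda>z. - coord 1 f z)"
    by (rule weak[OF order_refl ab order_refl T1])
  then obtain w2 where w2: "ac_rep a b (coord 2 e) w2 (\<lambda>z. - coord 1 f z)"
    using rep[OF order_refl ab order_refl] by auto
  \<comment> \<open>\<open>J0\<close> discards coordinates 3 and 4, so any effort there goes with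
    zero flow. Taking those of \<open>f\<close> turns the pairing into the squared norm of these two
    flows.\<close>
  define g :: "real \<Rightarrow> real^4" where "g = (\<lambda>z. vector [0, 0, coord 3 f z, coord 4 f z])"
  have g: "coord 1 g = (\<lambda>z. 0)" "coord 2 g = (\<lambda>z. 0)" "coord 3 g = coord 3 f" "coord 4 g = coord 4 f"
    by (simp_all add: g_def coord_def vector_4)
  have "g \<in> L2 {a..b}" unfolding L2_coord forall_4 g using fc L2_zero by simp
  then have "port_rep (0, 0, 0) (g, 0, 0) (\<lambda>z. 0) (\<lambda>z. 0) (\<lambda>z. 0)"
    using port_rep_zero by (simp add: port_rep_def zero_prod_def bulk_rep_def g coord_zero)
  then have "((0, 0, 0), (g, 0, 0)) \<in> D_J0 a b" unfolding D_J0_iff by blast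
  with w have "plus_pairing (power_pairing a b) ((0, 0, 0), (g, 0, 0)) ((f, fI, fd), (e, eI, ed)) = 0"
    by (auto simp: orth_companion_def)
  then have "(LINT z|lebesgue_on {a..b}. g z \<bullet> f z) = 0"
    by (simp add: plus_pairing_def power_pairing_def)
  then have "(LINT z|lebesgue_on {a..b}. coord 3 f z * coord 3 f z + coord 4 f z * coord 4 f z) = 0"
    by (simp add: inner_coord g)
  then have "AE z in lebesgue_on {a..b}. coord 3 f z * coord 3 f z + coord 4 f z * coord 4 f z = 0"
    by (subst (asm) integral_nonneg_eq_0_iff_AE)
       (auto intro!: Bochner_Integration.integrable_add integrable_L2_mult fc)
  then have "AE z in lebesgue_on {a..b}. coord 3 f z = 0 \<and> coord 4 f z = 0"
    by eventually_elim (simp add: sum_squares_eq_zero_iff)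
  with wl wr w2 have "bulk_rep f e wl wr w2" by (simp add: bulk_rep_def)
  with that f e show thesis by blast
qed

lemma orth_subset_D_J0:
  assumes w: "((f, fI, fd), (e, eI, ed)) \<in> orth_companion (bond_space a b) (power_pairing a b) (D_J0 a b)"
  shows "((f, fI, fd), (e, eI, ed)) \<in> D_J0 a b"
proof -
  obtain wl wr w2 where rep: "bulk_rep f e wl wr w2" and f: "f \<in> L2 {a..b}" and e: "e \<in> L2 {a..b}"
    using orth_bulk_rep[OF w] by blast
  \<comment> \<open>With representatives of \<open>e\<close> at hand, integration by parts removes
    all integrals: orthogonality is now an identity between finitely many boundary values.\<close>
  have key: "- (yl 0 * w2 0 - yl a * w2 a + (wl 0 * y2 0 - wl a * y2 a)) -
      (yr b * w2 b - yr 0 * w2 0 + (wr b * y2 b - wr 0 * y2 0)) + (yl 0 - yr 0) * fI + eI * y2 0 =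
     ((yr b + yl a) * fd $ 1 + (y2 b + y2 a) * fd $ 2 +
       ed $ 1 * (y2 a - y2 b) + ed $ 2 * (yl a - yr b)) / sqrt 2"
    if "\<And>z. (yl has_real_derivative gl z) (at z)" "continuous_on UNIV gl"
      "\<And>z. (yr has_real_derivative gr z) (at z)" "continuous_on UNIV gr"
      "\<And>z. (y2 has_real_derivative g2 z) (at z)" "continuous_on UNIV g2"
    for yl gl yr gr y2 g2
  proof -
    have "(LINT z|lebesgue_on {a..b}. test_effort yl yr y2 z \<bullet> f z) +
     (LINT z|lebesgue_on {a..b}. e z \<bullet> test_flow gl gr g2 z) =
     - (yl 0 * w2 0 - yl a * w2 a + (wl 0 * y2 0 - wl a * y2 a)) -
      (yr b * w2 b - yr 0 * w2 0 + (wr b * y2 b - wr 0 * y2 0))"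
      by (rule bulk_pairing[OF _ rep _ _ f e]) (use test_port[OF that] in \<open>simp_all add: port_rep_def\<close>)
    then show ?thesis using orth_test[OF w that] by simp
  qed
  \<comment> \<open>\<open>y2\<close> has three values to prescribe, at \<open>a\<close>,
    \<open>0\<close> and \<open>b\<close>, hence degree two; \<open>yl\<close> and \<open>yr\<close>
    have two each and are taken affine.\<close>
  have quad: "((\<lambda>z. p + q * z + r * z\<^sup>2) has_real_derivative q + 2 * r * z) (at z)" for p q r z :: real
    by (auto intro!: derivative_eq_intros)
  have lin: "continuous_on UNIV (\<lambda>z :: real. q + 2 * r * z)" for q r :: real
    by (intro continuous_intros)
  define s where "s = sqrt 2"
  have s: "s > 0" "s * s = 2" by (simp_all add: s_def)
  \<comment> \<open>The instances below list the coefficients in their order of occurrence,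
    \<open>p p' r r' r'' q q'\<close>: the first two belong to \<open>yl\<close>, the next three to
    \<open>y2\<close>, the last two to \<open>yr\<close>.\<close>
  have K: "- (p * w2 0 - (p + p' * a) * w2 a + (wl 0 * r - wl a * (r + r' * a + r'' * a\<^sup>2))) -
      ((q + q' * b) * w2 b - q * w2 0 + (wr b * (r + r' * b + r'' * b\<^sup>2) - wr 0 * r)) + (p - q) * fI + eI * r =
     ((q + q' * b + (p + p' * a)) * fd $ 1 + (r + r' * b + r'' * b\<^sup>2 + (r + r' * a + r'' * a\<^sup>2)) * fd $ 2 +
     ed $ 1 * (r + r' * a + r'' * a\<^sup>2 - (r + r' * b + r'' * b\<^sup>2)) + ed $ 2 * (p + p' * a - (q + q' * b))) / s"
    for p p' q q' r r' r''
    using key[OF quad[of p p' 0] lin[of p' 0] quad[of q q' 0] lin[of q' 0] quad[of r r' r''] lin[of r' r'']]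
    by (simp add: s_def)
  have cancel: "y = s * x" if "c * x = c * y / s" "c \<noteq> 0" for c x y
    using that s by (simp add: field_simps)
  \<comment> \<open>\<open>yl z = z\<close> here and \<open>yr z = z\<close> in the next one: zero
    at \<open>0\<close>, so only the outer endpoint contributes.\<close>
  have 1: "fd $ 1 + ed $ 2 = s * w2 a"
    by (rule cancel[of a]) (use K[of 0 1 0 0 0 0 0] a0 in \<open>simp_all add: algebra_simps\<close>)
  have 2: "ed $ 2 - fd $ 1 = s * w2 b"
    by (rule cancel[of "- b"]) (use K[of 0 0 0 0 0 0 1] b0 in \<open>simp_all add: algebra_simps\<close>)
  \<comment> \<open>\<open>y2 z = z * (z - b)\<close> vanishes at \<open>0\<close> and
    \<open>b\<close> and equals \<open>a * (a - b)\<close> at \<open>a\<close>; the next one uses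
    \<open>z * (z - a)\<close> in the same way.\<close>
  have 3: "fd $ 2 + ed $ 1 = s * wl a"
    by (rule cancel[of "a * (a - b)"])
      (use K[of 0 0 0 "- b" 1 0 0] a0 b0 in \<open>simp_all add: algebra_simps power2_eq_square\<close>)
  have 4: "ed $ 1 - fd $ 2 = s * wr b"
    by (rule cancel[of "- b * (b - a)"])
      (use K[of 0 0 0 "- a" 1 0 0] a0 b0 in \<open>simp_all add: algebra_simps power2_eq_square\<close>)
  \<comment> \<open>The constant \<open>yl = 1\<close> contributes at \<open>a\<close> and at
    \<open>0\<close>. The part at \<open>a\<close> is known from 1 and drops out.\<close>
  have "w2 a = (fd $ 1 + ed $ 2) / s" using 1 s by simp
  then have 5: "fI = w2 0"
    using K[of 1 0 0 0 0 0 0] by simp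
  \<comment> \<open>For the constant \<open>y2 = 1\<close> the contributions of \<open>a\<close> and
    \<open>b\<close> are known from 3 and 4, which leaves the jump at \<open>0\<close>.\<close>
  have "wl a - wr b = (fd $ 2 + ed $ 1) / s - (ed $ 1 - fd $ 2) / s" using 3 4 s by simp
  then have 6: "eI = wl 0 - wr 0"
    using K[of 0 0 1 0 0 0 0] by (simp add: field_simps flip: diff_divide_distrib)
  have "2 * fd $ 1 = s * (w2 a - w2 b)" "2 * fd $ 2 = s * (wl a - wr b)"
    "2 * ed $ 1 = s * (wr b + wl a)" "2 * ed $ 2 = s * (w2 b + w2 a)"
    using 1 2 3 4 by (simp_all add: algebra_simps)
  moreover have "s * x = y" if "2 * x = s * y" for x y
  proof -
    have "s * (2 * x) = 2 * y" using that s by (simp flip: mult.assoc)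
    then show ?thesis by simp
  qed
  ultimately have "port_rep (f, fI, fd) (e, eI, ed) wl wr w2"
    using 5 6 rep f e by (simp add: port_rep_def s_def)
  then show ?thesis unfolding D_J0_iff by blast
qed

lemma D_J0_dirac: "dirac_structure (bond_space a b) (power_pairing a b) (D_J0 a b)"
proof -
  have sub: "D_J0 a b \<subseteq> bond_space a b" by (auto simp: D_J0_def)
  have "D_J0 a b \<subseteq> orth_companion (bond_space a b) (power_pairing a b) (D_J0 a b)"
    using sub D_J0_isotropic by (auto simp: orth_companion_def)
  moreover have "orth_companion (bond_space a b) (power_pairing a b) (D_J0 a b) \<subseteq> D_J0 a b"
  proof
    fix w assume "w \<in> orth_companion (bond_space a b) (power_pairing a b) (D_J0 a b)"
    then show "w \<in> D_J0 a b"
      by (metis orth_subset_D_J0 prod.exhaust)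
  qed
  ultimately show ?thesis
    using sub subspace_D_J0 by (simp add: dirac_structure_def subset_antisym)
qed

end

end

theorem proposition5p5:
  fixes a b :: real
  assumes "a < 0" and "0 < b"
  shows "dirac_structure (bond_space a b) (power_pairing a b) (D_J0 a b)"
  using assms by (rule D_J0_dirac)

end
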